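(* Let $N\ge1$. The Macdonald currents $\mathfrak e(z),\mathfrak f(z)$, together with the series $$\psi^{\pm}(z)=\prod_{i=1}^{N}\frac{(1-q^{-1/2}t(zx_i)^{\pm1})(1-q^{1/2}t^{-1}(zx_i)^{\pm1})}{(1-q^{-1/2}(zx_i)^{\pm1})(1-q^{1/2}(zx_i)^{\pm1})}$$ (expanded as power series in $z^{\pm1}$ and acting by multiplication), satisfy the relations of the level $(0,0)$ quantum toroidal $\widehat{\mathfrak{gl}}_1$ algebra, namely, as identities between formal series in $z,w,z_1,z_2,z_3$ and their inverses with coefficients operators on symmetric functions of $x_1,\dots,x_N$: $$g(z,w)\mathfrak e(z)\mathfrak e(w)+g(w,z)\mathfrak e(w)\mathfrak e(z)=0,\qquad g(w,z)\mathfrak f(z)\mathfrak f(w)+g(z,w)\mathfrak f(w)\mathfrak f(z)=0,$$ $$g(z,w)\psi^\pm(z)\mathfrak e(w)+g(w,z)\mathfrak e(w)\psi^\pm(z)=0,\qquad g(w,z)\psi^\pm(z)\mathfrak f(w)+g(z,w)\mathfrak f(w)\psi^\pm(z)=0,$$ $$[\mathfrak e(z),\mathfrak f(w)]=\frac{\delta(z/w)}{g(1,1)}\big(\psi^+(z)-\psi^-(z)\big),$$ $$\mathrm{Sym}_{z_1,z_2,z_3}\Big(\frac{z_2}{z_3}\big[\mathfrak e(z_1),[\mathfrak e(z_2),\mathfrak e(z_3)]\big]\Big)=0,\qquad \mathrm{Sym}_{z_1,z_2,z_3}\Big(\frac{z_2}{z_3}\big[\mathfrak f(z_1),[\mathfrak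 f(z_2),\mathfrak f(z_3)]\big]\Big)=0,$$ and moreover the constant terms $\psi_0^{\pm}$ of $\psi^\pm(z)$ equal $1$ and all coefficients of $\psi^+(z)$ and $\psi^-(z)$ mutually commute.
   Context: $q,t$ are generic parameters (indeterminates), $\theta=t^{1/2}$. Operators act on symmetric rational functions of $x_1,\dots,x_N$ over $\mathbb C(q^{1/2},t^{1/2})$. $\Gamma_i$ is the shift $x_i\mapsto qx_i$ (other variables fixed) and $\Gamma_i^{-1}$ its inverse. $\delta(u)=\sum_{n\in\mathbb Z}u^n$, and $$g(z,w)=(z-qw)(z-t^{-1}w)(z-q^{-1}tw).$$ $\mathrm{Sym}_{z_1,z_2,z_3}$ is the sum over all permutations of $z_1,z_2,z_3$. For $n\in\mathbb Z$ define $$\mathcal D_{1;n}^{q,t}=\sum_{i=1}^N x_i^n\prod_{j\ne i}\frac{\theta x_i-\theta^{-1}x_j}{x_i-x_j}\,\Gamma_i,\qquad \mathcal D_{1;n}^{q^{-1},t^{-1}}=\sum_{i=1}^N x_i^n\prod_{j\ne i}\frac{\theta^{-1} x_i-\theta x_j}{x_i-x_j}\,\Gamma_i^{-1}.$$ The (fundamental) Macdonald currents are $$\mathfrak e(z)=\frac{q^{1/2}}{1-q}\sum_{n\in\mathbb Z}q^{n/2}z^n\,\mathcal D_{1;n}^{q,t},\qquad \mathfrak f(z)=\frac{q^{-1/2}}{1-q^{-1}}\sum_{n\in\mathbb Z}q^{-n/2}z^n\,\mathcal D_{1;n}^{q^{-1},t^{-1}}.$$ *)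

theory Defs
  imports
    "HOL-Library.Poly_Mapping"
    "HOL-Library.Product_Plus"
    "HOL-Computational_Algebra.Computational_Algebra"
    "HOL-Combinatorics.Permutations"
begin

section \<open>The ground field \<open>\<complex>(q\<^sup>1\<^sup>/\<^sup>2, t\<^sup>1\<^sup>/\<^sup>2)\<close>\<close>

text \<open>The inner polynomial variable is \<open>q\<^sup>1\<^sup>/\<^sup>2\<close>, the outer one is \<open>\<theta> = t\<^sup>1\<^sup>/\<^sup>2\<close>.\<close>

type_synonym qtfield = "complex poly poly fract"

definition qh :: qtfield where "qh = Fract [:[:0, 1:]:] 1"
definition th :: qtfield where "th = Fract [:0, 1:] 1"

definition qq :: qtfield where "qq = qh ^ 2"
definition tt :: qtfield where "tt = th ^ 2"

section \<open>Rational functions and symmetric rational functions of \<open>x\<^sub>1, \<dots>, x\<^sub>N\<close>\<close>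

text \<open>
  Polynomials in countably many variables are finitely supported functions on monomials, a monomial
  being a finitely supported function from variable indices to exponents. All \<open>N\<close> share the
  resulting field; the subset \<open>ratN N\<close> is the field of rational functions in \<open>x\<^sub>1, \<dots>, x\<^sub>N\<close> only.
\<close>

type_synonym pol = "(nat \<Rightarrow>\<^sub>0 nat) \<Rightarrow>\<^sub>0 qtfield"
type_synonym ratfun = "pol fract"

definition cst :: "qtfield \<Rightarrow> ratfun" where
  "cst c = Fract (Poly_Mapping.single 0 c) 1"

definition X :: "nat \<Rightarrow> ratfun" where
  "X i = Fract (Poly_Mapping.single (Poly_Mapping.single i 1) 1) 1"

definition polN :: "nat \<Rightarrow> pol set" where
  "polN N = {p. \<forall>m \<in> Poly_Mapping.keys p. Poly_Mapping.keys m \<subseteq> {1..N}}"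

definition ratN :: "nat \<Rightarrow> ratfun set" where
  "ratN N = {Fract a b | a b. a \<in> polN N \<and> b \<in> polN N \<and> b \<noteq> 0}"

definition psubst :: "(nat \<Rightarrow> ratfun) \<Rightarrow> pol \<Rightarrow> ratfun" where
  "psubst \<sigma> p = (\<Sum>m \<in> Poly_Mapping.keys p.
     cst (Poly_Mapping.lookup p m) *
     (\<Prod>i \<in> Poly_Mapping.keys m. \<sigma> i ^ Poly_Mapping.lookup m i))"

text \<open>
  The substitution \<open>x\<^sub>i \<mapsto> \<sigma> i\<close> in a rational function. It is meaningful when the \<open>\<sigma> i\<close> are
  algebraically independent, so that no nonzero denominator is sent to \<open>0\<close> and the value does not
  depend on the fraction chosen; it is used only for \<open>\<sigma>\<close> that permute or rescale the variables.
\<close>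

definition rsubst :: "(nat \<Rightarrow> ratfun) \<Rightarrow> ratfun \<Rightarrow> ratfun" where
  "rsubst \<sigma> f = (THE r. \<exists>a b. b \<noteq> 0 \<and> f = Fract a b \<and> r = psubst \<sigma> a / psubst \<sigma> b)"

definition symN :: "nat \<Rightarrow> ratfun set" where
  "symN N = {f \<in> ratN N. \<forall>\<pi>. \<pi> permutes {1..N} \<longrightarrow> rsubst (\<lambda>i. X (\<pi> i)) f = f}"

section \<open>Macdonald operators, currents, and the series \<open>\<psi>\<^sup>\<plusminus>\<close>\<close>

text \<open>\<open>shift c i\<close> is \<open>x\<^sub>i \<mapsto> c x\<^sub>i\<close>; thus \<open>\<Gamma>\<^sub>i\<close> is \<open>shift qq i\<close> and its inverse is \<open>shift (1 / qq) i\<close>.\<close>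

definition shift :: "qtfield \<Rightarrow> nat \<Rightarrow> ratfun \<Rightarrow> ratfun" where
  "shift c i = rsubst (X(i := cst c * X i))"

text \<open>
  \<open>mac_D N c s n\<close> is \<open>\<D>\<^bsub>1;n\<^esub>\<close> with parameters \<open>c\<close> and \<open>s\<^sup>2\<close>: the parameter values \<open>(qq, th)\<close> give
  the superscript \<open>q, t\<close> and \<open>(1 / qq, 1 / th)\<close> give the superscript \<open>q\<^sup>-\<^sup>1, t\<^sup>-\<^sup>1\<close>.
\<close>

definition mac_D :: "nat \<Rightarrow> qtfield \<Rightarrow> qtfield \<Rightarrow> int \<Rightarrow> ratfun \<Rightarrow> ratfun" where
  "mac_D N c s n f = (\<Sum>i = 1..N. X i powi n *
     (\<Prod>j \<in> {1..N} - {i}. (cst s * X i - cst (1 / s) * X j) / (X i - X j)) * shift c i f)"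

text \<open>
  A formal series \<open>\<Sum>\<^sub>\<alpha> A\<^sub>\<alpha> z\<^sup>\<alpha>\<close> that is infinite in all directions is its coefficient function
  \<open>\<alpha> \<mapsto> A\<^sub>\<alpha>\<close>, where \<open>\<alpha>\<close> is an integer for series in \<open>z\<close>, a pair for series in \<open>z, w\<close>, and a triple
  for series in \<open>z\<^sub>1, z\<^sub>2, z\<^sub>3\<close>.
\<close>

type_synonym 'e opseries = "'e \<Rightarrow> ratfun \<Rightarrow> ratfun"

definition cur_e :: "nat \<Rightarrow> int opseries" where
  "cur_e N n f = cst (qh / (1 - qq) * qh powi n) * mac_D N qq th n f"

definition cur_f :: "nat \<Rightarrow> int opseries" where
  "cur_f N n f = cst ((1 / qh) / (1 - 1 / qq) * qh powi (- n)) * mac_D N (1 / qq) (1 / th) n f"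

text \<open>
  The power series whose variable \<open>fps_X\<close> stands for \<open>z\<close> when \<open>u i = x\<^sub>i\<close>, and for \<open>z\<^sup>-\<^sup>1\<close> when
  \<open>u i = x\<^sub>i\<^sup>-\<^sup>1\<close>.
\<close>

definition psi_fps :: "nat \<Rightarrow> (nat \<Rightarrow> ratfun) \<Rightarrow> ratfun fps" where
  "psi_fps N u = (\<Prod>i = 1..N.
     ((1 - fps_const (cst (tt / qh) * u i) * fps_X) * (1 - fps_const (cst (qh / tt) * u i) * fps_X)) /
     ((1 - fps_const (cst (1 / qh) * u i) * fps_X) * (1 - fps_const (cst qh * u i) * fps_X)))"

definition psi_plus_coeff :: "nat \<Rightarrow> int \<Rightarrow> ratfun" where
  "psi_plus_coeff N n = (if n \<ge> 0 then fps_nth (psi_fps N X) (nat n) else 0)"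

definition psi_minus_coeff :: "nat \<Rightarrow> int \<Rightarrow> ratfun" where
  "psi_minus_coeff N n = (if n \<le> 0 then fps_nth (psi_fps N (\<lambda>i. inverse (X i))) (nat (- n)) else 0)"

definition psi_plus :: "nat \<Rightarrow> int opseries" where
  "psi_plus N n f = psi_plus_coeff N n * f"

definition psi_minus :: "nat \<Rightarrow> int opseries" where
  "psi_minus N n f = psi_minus_coeff N n * f"

section \<open>Calculus of formal series with operator coefficients\<close>

definition preserves_sym :: "nat \<Rightarrow> (ratfun \<Rightarrow> ratfun) \<Rightarrow> bool" where
  "preserves_sym N A \<longleftrightarrow> (\<forall>f \<in> symN N. A f \<in> symN N)"

text \<open>Equality of formal series whose coefficients are operators on symmetric functions.\<close>

definition ser_eq :: "nat \<Rightarrow> 'e opseries \<Rightarrow> 'e opseries \<Rightarrow> bool" where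
  "ser_eq N S T \<longleftrightarrow> (\<forall>\<alpha>. \<forall>f \<in> symN N. S \<alpha> f = T \<alpha> f)"

definition ser_zero :: "'e opseries" where "ser_zero = (\<lambda>\<alpha> f. 0)"

definition ser_add :: "'e opseries \<Rightarrow> 'e opseries \<Rightarrow> 'e opseries" (infixl \<open>\<oplus>\<^sub>s\<close> 65) where
  "S \<oplus>\<^sub>s T = (\<lambda>\<alpha> f. S \<alpha> f + T \<alpha> f)"

definition ser_diff :: "'e opseries \<Rightarrow> 'e opseries \<Rightarrow> 'e opseries" (infixl \<open>\<ominus>\<^sub>s\<close> 65) where
  "S \<ominus>\<^sub>s T = (\<lambda>\<alpha> f. S \<alpha> f - T \<alpha> f)"

text \<open>Multiplication of a formal series by a Laurent polynomial (an element of the group algebra).\<close>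

definition laurent_mult ::
  "(('e :: ab_group_add) \<Rightarrow>\<^sub>0 qtfield) \<Rightarrow> 'e opseries \<Rightarrow> 'e opseries" (infixr \<open>\<odot>\<^sub>s\<close> 70) where
  "p \<odot>\<^sub>s S = (\<lambda>\<alpha> f. \<Sum>\<beta> \<in> Poly_Mapping.keys p. cst (Poly_Mapping.lookup p \<beta>) * S (\<alpha> - \<beta>) f)"

text \<open>The products \<open>A(z) B(w)\<close> and \<open>A(w) B(z)\<close>, as series in \<open>z, w\<close>.\<close>

definition prod_zw :: "int opseries \<Rightarrow> int opseries \<Rightarrow> (int \<times> int) opseries" where
  "prod_zw A B = (\<lambda>(a, b). A a \<circ> B b)"

definition prod_wz :: "int opseries \<Rightarrow> int opseries \<Rightarrow> (int \<times> int) opseries" where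
  "prod_wz A B = (\<lambda>(a, b). A b \<circ> B a)"

text \<open>
  \<open>\<delta>(z/w) S(z)\<close>: since \<open>\<delta>(z/w) = \<Sum>\<^sub>n z\<^sup>n w\<^sup>-\<^sup>n\<close>, only \<open>n = - b\<close> contributes to the coefficient of
  \<open>z\<^sup>a w\<^sup>b\<close>, and it contributes the coefficient of \<open>z\<^sup>a\<^sup>+\<^sup>b\<close> in \<open>S\<close>.
\<close>

definition delta_mult :: "int opseries \<Rightarrow> (int \<times> int) opseries" where
  "delta_mult S = (\<lambda>(a, b). S (a + b))"

definition comm_op :: "(ratfun \<Rightarrow> ratfun) \<Rightarrow> (ratfun \<Rightarrow> ratfun) \<Rightarrow> ratfun \<Rightarrow> ratfun" where
  "comm_op A B f = A (B f) - B (A f)"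

text \<open>\<open>[A(z\<^sub>1), [A(z\<^sub>2), A(z\<^sub>3)]]\<close>\<close>

definition double_comm :: "int opseries \<Rightarrow> (int \<times> int \<times> int) opseries" where
  "double_comm A = (\<lambda>(a, b, c). comm_op (A a) (comm_op (A b) (A c)))"

definition sym3 :: "(int \<times> int \<times> int) opseries \<Rightarrow> (int \<times> int \<times> int) opseries" where
  "sym3 S = (\<lambda>(a, b, c) f. S (a, b, c) f + S (a, c, b) f + S (b, a, c) f +
                           S (b, c, a) f + S (c, a, b) f + S (c, b, a) f)"

text \<open>
  The polynomial \<open>g\<close>, evaluated in any commutative algebra over the ground field with structure
  map \<open>\<iota>\<close>: the Laurent polynomials in \<open>z, w\<close>, or (for \<open>g(1,1)\<close>) the ground field itself.
\<close>

definition gpol :: "(qtfield \<Rightarrow> 'a :: comm_ring_1) \<Rightarrow> 'a \<Rightarrow> 'a \<Rightarrow> 'a" where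
  "gpol \<iota> z w = (z - \<iota> qq * w) * (z - \<iota> (1 / tt) * w) * (z - \<iota> (tt / qq) * w)"

definition zvar :: "(int \<times> int) \<Rightarrow>\<^sub>0 qtfield" where "zvar = Poly_Mapping.single (1, 0) 1"
definition wvar :: "(int \<times> int) \<Rightarrow>\<^sub>0 qtfield" where "wvar = Poly_Mapping.single (0, 1) 1"

definition g_zw :: "(int \<times> int) \<Rightarrow>\<^sub>0 qtfield" where
  "g_zw = gpol (Poly_Mapping.single 0) zvar wvar"

definition g_wz :: "(int \<times> int) \<Rightarrow>\<^sub>0 qtfield" where
  "g_wz = gpol (Poly_Mapping.single 0) wvar zvar"

definition g_one_one :: qtfield where "g_one_one = gpol (\<lambda>c. c) 1 1"

text \<open>The Laurent monomial \<open>z\<^sub>2 / z\<^sub>3\<close>.\<close>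

definition z2_over_z3 :: "(int \<times> int \<times> int) \<Rightarrow>\<^sub>0 qtfield" where
  "z2_over_z3 = Poly_Mapping.single (0, 1, - 1) 1"

end

theory Submission
  imports Defs
begin

text \<open>
  Put \<open>y\<^sub>i = q\<^sup>1\<^sup>/\<^sup>2 x\<^sub>i\<close>. Then \<open>e(z)\<close> is, up to a constant, \<open>\<Sum>\<^sub>i \<delta>(z y\<^sub>i) A\<^sub>i \<Gamma>\<^sub>i\<close>, so that \<open>z\<close> may be
  replaced by \<open>1 / y\<^sub>i\<close> in the \<open>i\<close>-th summand. In a product of two currents the factor of the
  coefficient that involves both \<open>y\<^sub>i\<close> and \<open>y\<^sub>j\<close> is \<open>g(1 / y\<^sub>j, 1 / y\<^sub>i)\<close> times a function antisymmetric
  in \<open>i, j\<close>. This gives the quadratic relations, and it reduces the part of the Serre relation with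
  three distinct shifts to a polynomial identity of degree 12; the terms with \<open>\<Gamma>\<^sub>i\<^sup>2 \<Gamma>\<^sub>k\<close> cancel by a
  three-term identity, and those with \<open>\<Gamma>\<^sub>i\<^sup>3\<close> carry a vanishing factor. In \<open>[e(z), f(w)]\<close> the
  summands with \<open>i \<noteq> j\<close> cancel, and the diagonal ones are the terms of the partial fraction
  decomposition of the rational function whose expansions at \<open>0\<close> and \<open>\<infinity>\<close> are \<open>\<psi>\<^sup>+\<close> and \<open>\<psi>\<^sup>-\<close>.
  Every relation for \<open>f\<close> is the one for \<open>e\<close> with \<open>q\<close> and \<open>t\<close> inverted.
\<close>

section \<open>Rational identities\<close>

text \<open>Relations are compared coefficient by coefficient. Every coefficient is a finite sum
  over indices, so no formal distribution is manipulated; a delta function survives only as the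
  power \<open>y i powi n\<close>. What has to be controlled instead is division: the weights have
  poles at \<open>y i = y j\<close> and \<open>y i = q * y j\<close>, which independent variables
  never meet for distinct indices. The factor q^(1/2) in the rescaled variables makes
  \<open>y i\<close> and \<open>y i / q\<close> the coefficients of z in the linear denominators of
  psi^+, and \<open>y i / q\<close> is at the same time the variable natural for f. Hence e and f
  are two instances of one locale, with data \<open>y\<close>, \<open>q\<close>, \<open>s\<close>
  and \<open>y / q\<close>, \<open>1 / q\<close>, \<open>1 / s\<close>, where \<open>s\<close> is
  the square root of t. The relations are proved over a field with commuting endomorphisms rescaling
  the \<open>y i\<close>. To apply them, the shifts, defined by a definite description on fractions,
  must be shown to be field endomorphisms; this rests on inverting the substitution on
  polynomials.\<close>

locale field_endo =
  fixes \<phi> :: "'a::field \<Rightarrow> 'a"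
  assumes add: "\<phi> (a + b) = \<phi> a + \<phi> b"
    and mult: "\<phi> (a * b) = \<phi> a * \<phi> b"
    and one: "\<phi> 1 = 1"
begin

lemma zero: "\<phi> 0 = 0"
  using add[of 0 0] by (metis add_cancel_right_left)

lemma minus: "\<phi> (- a) = - \<phi> a"
  using add[of a "- a"] zero by (simp add: eq_neg_iff_add_eq_0 add.commute)

lemma diff: "\<phi> (a - b) = \<phi> a - \<phi> b"
  using add[of a "- b"] by (simp add: minus)

lemma nonzero: "a \<noteq> 0 \<Longrightarrow> \<phi> a \<noteq> 0"
  using mult[of a "inverse a"] one by auto

lemma inj: "\<phi> a = \<phi> b \<longleftrightarrow> a = b"
  using nonzero[of "a - b"] by (auto simp: diff)

lemma inverse: "\<phi> (inverse a) = inverse (\<phi> a)"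
proof (cases "a = 0")
  case False
  then have "\<phi> a * \<phi> (inverse a) = 1"
    by (simp flip: mult add: one)
  then show ?thesis
    by (metis inverse_unique)
qed (simp add: zero)

lemma divide: "\<phi> (a / b) = \<phi> a / \<phi> b"
  by (simp add: divide_inverse mult inverse)

lemma power: "\<phi> (a ^ n) = \<phi> a ^ n"
  by (induction n) (simp_all add: one mult)

lemma power_int: "\<phi> (a powi n) = \<phi> a powi n"
  by (simp add: power_int_def power inverse)

lemma sum: "\<phi> (sum f S) = (\<Sum>x\<in>S. \<phi> (f x))"
  by (induction S rule: infinite_finite_induct) (simp_all add: zero add)

lemma prod: "\<phi> (prod f S) = (\<Prod>x\<in>S. \<phi> (f x))"
  by (induction S rule: infinite_finite_induct) (simp_all add: one mult)

lemmas hom_simps = add mult one zero minus diff inverse divide power power_int sum prod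

end

lemma field_endo_comp: "field_endo \<phi> \<Longrightarrow> field_endo \<psi> \<Longrightarrow> field_endo (\<lambda>a. \<phi> (\<psi> a))"
  by (simp add: field_endo_def)

text \<open>With \<open>a = gcoef1 q t\<close> and \<open>b = gcoef2 q t\<close> below, \<open>cubic a b u v = u\<^sup>3 v\<^sup>3 g(1 / u, 1 / v)\<close>.\<close>

definition cubic :: "'a::field \<Rightarrow> 'a \<Rightarrow> 'a \<Rightarrow> 'a \<Rightarrow> 'a" where
  "cubic a b u v = v^3 - a * v^2 * u + b * v * u^2 - u^3"

text \<open>\<open>gcoef1\<close> and \<open>gcoef2\<close> are the first and second elementary
  symmetric functions of \<open>q\<close>, \<open>1 / t\<close>, \<open>t / q\<close>. The third is
  1, which is why the outer coefficients of \<open>cubic\<close> are 1 and -1.\<close>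

definition gcoef1 :: "'a::field \<Rightarrow> 'a \<Rightarrow> 'a" where "gcoef1 q t = q + 1 / t + t / q"
definition gcoef2 :: "'a::field \<Rightarrow> 'a \<Rightarrow> 'a" where "gcoef2 q t = 1 / q + t + q / t"

lemma cubic_factor:
  assumes "q \<noteq> 0" "t \<noteq> 0"
  shows "cubic (gcoef1 q t) (gcoef2 q t) u v = (v - q * u) * (v - u / t) * (v - t / q * u)"
proof -
  \<comment> \<open>With the inverses as symbols of their own the claim is a polynomial identity
    modulo \<open>q' * q = 1\<close> and \<open>t' * t = 1\<close>.\<close>
  obtain q' t' where i: "q' * q = 1" "t' * t = 1" "1 / q = q'" "1 / t = t'"
    using assms by (metis nonzero_divide_eq_eq)
  have d: "x / q = x * q'" "x / t = x * t'" for x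
    using i by (metis divide_inverse inverse_eq_divide)+
  show ?thesis unfolding cubic_def gcoef1_def gcoef2_def d i
    using i(1,2) by algebra
qed

definition mac_ratio :: "'a::field \<Rightarrow> 'a \<Rightarrow> 'a \<Rightarrow> 'a" where
  "mac_ratio s u v = (s * u - v / s) / (u - v)"

text \<open>Homogeneity of degree 0 allows the variables of the Macdonald operators to be rescaled
  by \<open>qh\<close> or \<open>1 / qh\<close>, and a factor \<open>q\<close> to be moved from one
  argument to the other.\<close>

lemma mac_ratio_scale:
  assumes "c \<noteq> 0"
  shows "mac_ratio s (c * u) (c * v) = mac_ratio s u v"
proof -
  have "s * (c * u) - c * v / s = c * (s * u - v / s)" "c * u - c * v = c * (u - v)"
    by (simp_all add: right_diff_distrib mult.left_commute)
  then show ?thesis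
    using assms by (simp add: mac_ratio_def)
qed

text \<open>What is left of the denominators of a pair weight once its numerator has been completed
  to the full cubic. Exchanging \<open>u\<close> and \<open>v\<close> swaps the last two factors, so
  only \<open>u - v\<close> contributes a sign.\<close>

definition antisym_denom :: "'a::field \<Rightarrow> 'a \<Rightarrow> 'a \<Rightarrow> 'a" where
  "antisym_denom q u v = (u - v) * (v - q * u) * (u - q * v)"

lemma antisym_denom_swap: "antisym_denom q v u = - antisym_denom q u v"
  by (simp add: antisym_denom_def algebra_simps)

lemma mac_ratio_mult:
  assumes "q \<noteq> 0" "s \<noteq> 0" "u \<noteq> q * v"
  shows "mac_ratio s u v * mac_ratio s v (q * u) =
    - q * cubic (gcoef1 q (s^2)) (gcoef2 q (s^2)) v u / antisym_denom q u v"
proof -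
  \<comment> \<open>The two ratios supply two linear factors of the cubic; expanding the fraction by
    \<open>u - q * v\<close> supplies the third.\<close>
  have "(s * u - v / s) * (s * v - q * u / s) * (u - q * v) =
    - q * cubic (gcoef1 q (s^2)) (gcoef2 q (s^2)) v u"
    using assms(1,2) by (simp add: cubic_factor) (simp add: field_simps power2_eq_square)
  then have "(s * u - v / s) * (s * v - q * u / s) / ((u - v) * (v - q * u)) =
    - q * cubic (gcoef1 q (s^2)) (gcoef2 q (s^2)) v u / (((u - v) * (v - q * u)) * (u - q * v))"
    using assms(3) by (metis right_minus_eq nonzero_mult_divide_mult_cancel_right)
  then show ?thesis
    by (simp add: mac_ratio_def antisym_denom_def)
qed

text \<open>
  Symmetrizing \<open>(z\<^sub>2 / z\<^sub>3) [e(z\<^sub>1), [e(z\<^sub>2), e(z\<^sub>3)]]\<close> amounts to multiplying the ordered product of three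
  currents by \<open>z\<^sub>2 / z\<^sub>3 - z\<^sub>3 / z\<^sub>2 - z\<^sub>1 / z\<^sub>2 + z\<^sub>2 / z\<^sub>1\<close>, here at \<open>z = 1 / u, 1 / v, 1 / w\<close>.
\<close>

definition serre_factor :: "'a::field \<Rightarrow> 'a \<Rightarrow> 'a \<Rightarrow> 'a" where
  "serre_factor u v w = w / v - v / w - v / u + u / v"

lemma serre_factor_eq:
  "u \<noteq> 0 \<Longrightarrow> v \<noteq> 0 \<Longrightarrow> w \<noteq> 0 \<Longrightarrow>
    serre_factor u v w = (u + w) * (u * w - v^2) / (u * v * w)"
  by (simp add: serre_factor_def field_simps power2_eq_square)

text \<open>The summands are the images of the first under the permutations of \<open>u\<close>,
  \<open>v\<close>, \<open>w\<close>, with the sign of the permutation; in the application the signs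
  come from the antisymmetric denominators. The parameters enter only through \<open>a\<close> and
  \<open>b\<close>, so this is a polynomial identity in five indeterminates.\<close>

lemma cubic_serre:
  fixes u v w a b :: "'a::field"
  defines "c \<equiv> cubic a b" and "k \<equiv> \<lambda>u v w. (u + w) * (u * w - v^2)"
  shows "k u v w * c v u * c w u * c w v - k v u w * c u v * c w v * c w u
       - k u w v * c w u * c v u * c v w + k v w u * c w v * c u v * c u w
       + k w u v * c u w * c v w * c v u - k w v u * c v w * c u w * c u v = 0"
  unfolding assms cubic_def by algebra

text \<open>\<open>T\<close> collects the indices of the shifts about to be applied: a shift at an
  index in \<open>T\<close> fixes every \<open>y l\<close> with \<open>l\<close> outside
  \<open>T\<close> and acts on the product through its argument alone.\<close>

definition mac_prod :: "'i set \<Rightarrow> ('i \<Rightarrow> 'a::field) \<Rightarrow> 'a \<Rightarrow> 'i set \<Rightarrow> 'a \<Rightarrow> 'a" where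
  "mac_prod I y s T u = (\<Prod>l\<in>I - T. mac_ratio s u (y l))"

lemma mac_prod_remove:
  assumes "finite I" "k \<in> I" "k \<notin> T"
  shows "mac_prod I y s T u = mac_ratio s u (y k) * mac_prod I y s (insert k T) u"
proof -
  have "finite (I - T)" "k \<in> I - T"
    using assms by auto
  from prod.remove[OF this, of "\<lambda>l. mac_ratio s u (y l)"] show ?thesis
    unfolding mac_prod_def Diff_insert[of I k T] .
qed

definition mac_coeff :: "'i set \<Rightarrow> ('i \<Rightarrow> 'a::field) \<Rightarrow> 'a \<Rightarrow> 'i \<Rightarrow> 'a" where
  "mac_coeff I y s i = mac_prod I y s {i} (y i)"

definition mac_current ::
  "'i set \<Rightarrow> ('i \<Rightarrow> 'a::field) \<Rightarrow> 'a \<Rightarrow> 'a \<Rightarrow> ('i \<Rightarrow> 'a \<Rightarrow> 'a) \<Rightarrow> int \<Rightarrow> 'a \<Rightarrow> 'a" where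
  "mac_current I y s C G n f = C * (\<Sum>i\<in>I. y i powi n * mac_coeff I y s i * G i f)"

section \<open>Currents attached to commuting shifts\<close>

text \<open>Adding the double sum to its transpose treats the diagonal and the off-diagonal pairs
  alike; the price is a division by 2.\<close>

lemma sum_pairs_antisym:
  fixes F :: "'i \<Rightarrow> 'i \<Rightarrow> 'a::field"
  assumes "(2::'a) \<noteq> 0" and "\<And>i j. i \<in> I \<Longrightarrow> j \<in> I \<Longrightarrow> F i j + F j i = 0"
  shows "(\<Sum>i\<in>I. \<Sum>j\<in>I. F i j) = 0"
proof -
  have "(\<Sum>i\<in>I. \<Sum>j\<in>I. F j i) = (\<Sum>i\<in>I. \<Sum>j\<in>I. F i j)"
    by (rule sum.swap)
  then have "2 * (\<Sum>i\<in>I. \<Sum>j\<in>I. F i j) = (\<Sum>i\<in>I. \<Sum>j\<in>I. F i j) + (\<Sum>i\<in>I. \<Sum>j\<in>I. F j i)"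
    by (metis mult_2)
  also have "\<dots> = 0"
    unfolding sum.distrib[symmetric] using assms(2) by (intro sum.neutral ballI)
  finally show ?thesis
    using assms(1) by simp
qed

text \<open>The six permutations of the summation variables give the same sum, so six times it is a
  sum of symmetrized terms, and triples with coinciding indices need no separate count.\<close>

lemma sum_triples_symmetrized:
  fixes F :: "'i \<Rightarrow> 'i \<Rightarrow> 'i \<Rightarrow> 'a::field"
  assumes "(6::'a) \<noteq> 0"
    and "\<And>i j k. i \<in> I \<Longrightarrow> j \<in> I \<Longrightarrow> k \<in> I \<Longrightarrow>
      F i j k + F i k j + F j i k + F j k i + F k i j + F k j i = 0"
  shows "(\<Sum>i\<in>I. \<Sum>j\<in>I. \<Sum>k\<in>I. F i j k) = 0" (is "?S F = 0")
proof -
  have swap23: "?S (\<lambda>i j k. H i k j) = ?S H" for H :: "'i \<Rightarrow> 'i \<Rightarrow> 'i \<Rightarrow> 'a"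
    by (rule sum.cong[OF refl]) (rule sum.swap)
  have swap12: "?S (\<lambda>i j k. H j i k) = ?S H" for H :: "'i \<Rightarrow> 'i \<Rightarrow> 'i \<Rightarrow> 'a"
    by (rule sum.swap)
  have "?S (\<lambda>i j k. F i k j) = ?S F" "?S (\<lambda>i j k. F j i k) = ?S F"
    by (fact swap23, fact swap12)
  moreover have "?S (\<lambda>i j k. F j k i) = ?S F"
    by (rule trans[OF swap12[of "\<lambda>i j k. F i k j"] swap23[of F]])
  moreover have "?S (\<lambda>i j k. F k i j) = ?S F"
    by (rule trans[OF swap23[of "\<lambda>i j k. F j i k"] swap12[of F]])
  moreover have "?S (\<lambda>i j k. F k j i) = ?S F"
    by (rule trans[OF swap12[of "\<lambda>i j k. F k i j"] trans[OF swap23[of "\<lambda>i j k. F j i k"] swap12[of F]]])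
  moreover have "?S (\<lambda>i j k. F i j k + F i k j + F j i k + F j k i + F k i j + F k j i) = 0"
    using assms(2) by (intro sum.neutral ballI)
  ultimately have "?S F + ?S F + ?S F + ?S F + ?S F + ?S F = 0"
    unfolding sum.distrib by argo
  then have "6 * ?S F = 0"
    by algebra
  then show ?thesis
    using assms(1) by simp
qed

text \<open>\<open>G i\<close> plays the q-shift of the i-th variable. The inequalities between
  distinct \<open>y\<close> exclude the poles of the weights, and \<open>six_nonzero\<close> serves
  the averaging over pairs and triples of indices.\<close>

locale shift_system =
  fixes I :: "'i set" and y :: "'i \<Rightarrow> 'a::field" and q s C :: 'a and G :: "'i \<Rightarrow> 'a \<Rightarrow> 'a"
  assumes finite_I: "finite I"
    and endo: "field_endo (G i)"
    and G_q: "G i q = q" and G_s: "G i s = s" and G_C: "G i C = C"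
    and G_y: "G i (y j) = (if i = j then q * y j else y j)"
    and G_commute: "G i (G j f) = G j (G i f)"
    and y_nonzero: "y i \<noteq> 0" and q_nonzero: "q \<noteq> 0" and s_nonzero: "s \<noteq> 0"
    and y_neq: "i \<noteq> j \<Longrightarrow> y i \<noteq> y j" and y_neq_q: "i \<noteq> j \<Longrightarrow> y i \<noteq> q * y j"
    and six_nonzero: "(6::'a) \<noteq> 0"
begin

abbreviation "E \<equiv> mac_current I y s C G"
abbreviation "A \<equiv> mac_coeff I y s"
abbreviation "R \<equiv> mac_prod I y s"
abbreviation "r \<equiv> mac_ratio s"
abbreviation "\<sigma>\<^sub>1 \<equiv> gcoef1 q (s^2)"
abbreviation "\<sigma>\<^sub>2 \<equiv> gcoef2 q (s^2)"

lemma two_nonzero: "(2::'a) \<noteq> 0"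
proof
  assume "(2::'a) = 0"
  then have "(3::'a) * 2 = 0" by simp
  then show False using six_nonzero by simp
qed

lemmas G_hom = field_endo.hom_simps[OF endo]

lemma G_ratio: "G i (r u v) = r (G i u) (G i v)"
  by (simp add: mac_ratio_def G_hom G_s)

lemma G_prod: "i \<in> T \<Longrightarrow> G i (R T u) = R T (G i u)"
  unfolding mac_prod_def G_hom
  by (intro prod.cong refl) (auto simp: G_ratio G_y)

lemma E_diff: "E n (f - g) = E n f - E n g"
  by (simp add: mac_current_def G_hom sum_subtractf right_diff_distrib)

lemma E_E:
  "E m (E n f) = C^2 * (\<Sum>i\<in>I. \<Sum>j\<in>I.
    A i * G i (A j) * (y i powi m * G i (y j) powi n) * G i (G j f))"
  unfolding mac_current_def G_hom G_C
  by (simp add: power2_eq_square sum_distrib_left mult_ac)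

lemma E_E_E:
  "E l (E m (E n f)) = C^3 * (\<Sum>i\<in>I. \<Sum>j\<in>I. \<Sum>k\<in>I.
    A i * G i (A j) * G i (G j (A k)) *
    (y i powi l * G i (y j) powi m * G i (G j (y k)) powi n) * G i (G j (G k f)))"
  unfolding E_E unfolding mac_current_def G_hom G_C
  by (simp add: power2_eq_square power3_eq_cube sum_distrib_left mult_ac)

lemma A_split:
  assumes "i \<in> I" "k \<in> I" "i \<noteq> k"
  shows "A i = r (y i) (y k) * R {i, k} (y i)"
  unfolding mac_coeff_def
  using assms finite_I by (subst mac_prod_remove[of _ k]) (auto simp: insert_commute)

text \<open>The factors with index outside \<open>{i, j}\<close> do not see \<open>G i\<close> at
  the argument \<open>y j\<close>, so they form a product symmetric in \<open>i\<close> and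
  \<open>j\<close>; the mutual factors are evaluated by \<open>mac_ratio_mult\<close>.\<close>

lemma weight_pair:
  assumes "i \<in> I" "j \<in> I" "i \<noteq> j"
  shows "A i * G i (A j) =
    - q * cubic \<sigma>\<^sub>1 \<sigma>\<^sub>2 (y j) (y i) / antisym_denom q (y i) (y j) * (R {i, j} (y i) * R {i, j} (y j))"
proof -
  have "A i = r (y i) (y j) * R {i, j} (y i)"
    by (rule A_split) fact+
  moreover have "A j = r (y j) (y i) * R {i, j} (y j)"
    using A_split[of j i] assms by (simp add: insert_commute)
  then have "G i (A j) = r (y j) (q * y i) * R {i, j} (y j)"
    using assms by (simp add: G_hom G_ratio G_prod G_y)
  ultimately have "A i * G i (A j) =
    r (y i) (y j) * r (y j) (q * y i) * (R {i, j} (y i) * R {i, j} (y j))"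
    by simp
  then show ?thesis
    by (simp only: mac_ratio_mult[OF q_nonzero s_nonzero y_neq_q[OF assms(3)]])
qed

text \<open>This is the coefficient of z^m w^n. Both orderings contribute the same cubic, so the
  double sum carries a monomial \<open>M\<close> symmetric in its arguments, and the terms of (i, j)
  and (j, i) differ only by the sign of \<open>antisym_denom\<close>.\<close>

lemma quadratic_relation:
  "E (m - 3) (E n f) - \<sigma>\<^sub>1 * E (m - 2) (E (n - 1) f) + \<sigma>\<^sub>2 * E (m - 1) (E (n - 2) f) - E m (E (n - 3) f) +
   (E (n - 3) (E m f) - \<sigma>\<^sub>1 * E (n - 2) (E (m - 1) f) + \<sigma>\<^sub>2 * E (n - 1) (E (m - 2) f) - E n (E (m - 3) f)) = 0"
proof -
  define M where "M = (\<lambda>u v :: 'a. u powi (m - 3) * v powi (n - 3) + u powi (n - 3) * v powi (m - 3))"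
  define F where "F = (\<lambda>i j. A i * G i (A j) * cubic \<sigma>\<^sub>1 \<sigma>\<^sub>2 (y i) (G i (y j)) *
    M (y i) (G i (y j)) * G i (G j f))"
  have powi: "u powi (m - 2) = u powi (m - 3) * u" "u powi (m - 1) = u powi (m - 3) * u^2"
    "u powi m = u powi (m - 3) * u^3" if "u \<noteq> 0" for u :: 'a and m
    using that power_int_add[of u "m - 3" 1] power_int_add[of u "m - 3" 2] power_int_add[of u "m - 3" 3]
    by (auto simp: algebra_simps)
  have nz: "y i \<noteq> 0" "G i (y j) \<noteq> 0" for i j
    using y_nonzero field_endo.nonzero[OF endo] by auto
  have F_eq: "F i j = A i * G i (A j) * (y i powi (m - 3) * G i (y j) powi n) * G i (G j f) -
      \<sigma>\<^sub>1 * (A i * G i (A j) * (y i powi (m - 2) * G i (y j) powi (n - 1)) * G i (G j f)) +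
      \<sigma>\<^sub>2 * (A i * G i (A j) * (y i powi (m - 1) * G i (y j) powi (n - 2)) * G i (G j f)) -
      A i * G i (A j) * (y i powi m * G i (y j) powi (n - 3)) * G i (G j f) +
      (A i * G i (A j) * (y i powi (n - 3) * G i (y j) powi m) * G i (G j f) -
      \<sigma>\<^sub>1 * (A i * G i (A j) * (y i powi (n - 2) * G i (y j) powi (m - 1)) * G i (G j f)) +
      \<sigma>\<^sub>2 * (A i * G i (A j) * (y i powi (n - 1) * G i (y j) powi (m - 2)) * G i (G j f)) -
      A i * G i (A j) * (y i powi n * G i (y j) powi (m - 3)) * G i (G j f))" for i j
    unfolding F_def M_def powi[OF nz(1), where m = n] powi[OF nz(1), where m = m]
      powi[OF nz(2), where m = n] powi[OF nz(2), where m = m] cubic_def by (simp add: algebra_simps)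
  have "(\<Sum>i\<in>I. \<Sum>j\<in>I. F i j) = 0"
  proof (rule sum_pairs_antisym[OF two_nonzero])
    fix i j assume ij: "i \<in> I" "j \<in> I"
    show "F i j + F j i = 0"
    proof (cases "i = j")
      \<comment> \<open>For \<open>i = j\<close> the second variable is \<open>q * y i\<close>, a
        root of the factor \<open>v - q * u\<close> of the cubic.\<close>
      case True
      then show ?thesis
        by (simp add: F_def G_y cubic_factor q_nonzero s_nonzero)
    next
      case False
      have "M (y j) (y i) = M (y i) (y j)"
        by (simp add: M_def mult_ac)
      with False show ?thesis
        unfolding F_def weight_pair[OF ij False] weight_pair[OF ij(2,1) False[symmetric]]
        by (simp add: G_y G_commute[of j i] insert_commute[of j i] antisym_denom_swap[of q "y j" "y i"] mult_ac)
    qed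
  qed
  moreover have "E (m - 3) (E n f) - \<sigma>\<^sub>1 * E (m - 2) (E (n - 1) f) + \<sigma>\<^sub>2 * E (m - 1) (E (n - 2) f) - E m (E (n - 3) f) +
   (E (n - 3) (E m f) - \<sigma>\<^sub>1 * E (n - 2) (E (m - 1) f) + \<sigma>\<^sub>2 * E (n - 1) (E (m - 2) f) - E n (E (m - 3) f)) =
   C^2 * (\<Sum>i\<in>I. \<Sum>j\<in>I. F i j)"
    unfolding E_E F_eq sum.distrib sum_subtractf sum_distrib_left[symmetric]
    by (simp add: algebra_simps)
  ultimately show ?thesis
    by simp
qed

end

section \<open>The Serre relation\<close>

lemma mac_ratio_eq: "s \<noteq> 0 \<Longrightarrow> mac_ratio s u v = (s^2 * u - v) / (s * (u - v))"
  by (cases "u = v") (simp_all add: mac_ratio_def field_simps power2_eq_square)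

text \<open>
  The Serre identity for the three orders of the shifts \<open>\<Gamma>\<^sub>i, \<Gamma>\<^sub>i, \<Gamma>\<^sub>k\<close>, with \<open>x = y\<^sub>i\<close> and \<open>y = y\<^sub>k\<close>.
\<close>

lemma mac_ratio_serre:
  fixes x y q s :: "'a::field"
  assumes nz: "x \<noteq> 0" "y \<noteq> 0" "q \<noteq> 0" "s \<noteq> 0"
    and neq: "x \<noteq> y" "y \<noteq> q * x" "x \<noteq> q * y" "y \<noteq> q * (q * x)"
  shows "mac_ratio s x y * mac_ratio s (q * x) y * mac_ratio s y (q * (q * x)) * serre_factor x (q * x) y +
    mac_ratio s x y * mac_ratio s y (q * x) * mac_ratio s (q * x) (q * y) * serre_factor x y (q * x) +
    mac_ratio s y x * mac_ratio s x (q * y) * mac_ratio s (q * x) (q * y) * serre_factor y x (q * x) = 0"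
    (is "?T1 + ?T2 + ?T3 = 0")
proof -
  define t d e m where "t = s^2" and "d = x - y" and "e = q * x - y" and "m = x * (q * x) * y"
  have [simp]: "d \<noteq> 0" "e \<noteq> 0" "m \<noteq> 0"
    using assms by (auto simp: d_def e_def m_def)
  have cancel: "c \<noteq> 0 \<Longrightarrow> a / (s * c) * (b * c / m) = a * b / (s * m)" for a b c
    by simp
  have flip: "a' = - a \<Longrightarrow> b' = - b \<Longrightarrow> a / (s * b) = a' / (s * b')" for a a' b b'
    by simp
  have r: "mac_ratio s x y = (t * x - y) / (s * d)"
    "mac_ratio s (q * x) y = (t * (q * x) - y) / (s * e)"
    "mac_ratio s y (q * (q * x)) = (t * y - q * (q * x)) / (s * (y - q * (q * x)))"
    "mac_ratio s y (q * x) = (q * x - t * y) / (s * e)"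
    "mac_ratio s (q * x) (q * y) = (t * x - y) / (s * d)"
    "mac_ratio s y x = (x - t * y) / (s * d)"
    "mac_ratio s x (q * y) = (t * x - q * y) / (s * (x - q * y))"
    unfolding mac_ratio_scale[OF nz(3)] unfolding mac_ratio_eq[OF nz(4)] t_def d_def e_def
    by (rule refl | rule flip, simp, simp)+
  have sf: "serre_factor u v w = p / m"
    if "u \<noteq> 0" "v \<noteq> 0" "w \<noteq> 0" "(u + w) * (u * w - v^2) = p" "u * v * w = m" for u v w p :: 'a
    using serre_factor_eq[OF that(1-3)] that(4,5) by simp
  \<comment> \<open>The factors \<open>y - q * (q * x)\<close> of \<open>k1\<close> and
    \<open>x - q * y\<close> of \<open>k3\<close> cancel the two denominators that occur in a single
    term only. Besides powers of \<open>s\<close>, the denominators left are \<open>d\<close>,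
    \<open>e\<close> and \<open>m\<close>.\<close>
  have k1: "serre_factor x (q * x) y = (x + y) * x * (y - q * (q * x)) / m"
    using nz by (intro sf) (simp_all add: m_def algebra_simps power2_eq_square)
  have k2: "serre_factor x y (q * x) = (1 + q) * x * (q * x^2 - y^2) / m"
    using nz by (intro sf) (simp_all add: m_def algebra_simps power2_eq_square)
  have k3: "serre_factor y x (q * x) = - (y + q * x) * x * (x - q * y) / m"
    using nz by (intro sf) (simp_all add: m_def algebra_simps power2_eq_square)
  have T1: "?T1 = (t * x - y) / (s * d) * ((t * (q * x) - y) / (s * e)) *
      ((t * y - q * (q * x)) * ((x + y) * x) / (s * m))"
    unfolding r k1 using cancel[of "y - q * (q * x)"] neq(4) by (simp only: mult.assoc) simp
  have T3: "?T3 = (x - t * y) / (s * d) * ((t * x - y) / (s * d)) *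
      ((t * x - q * y) * (- (y + q * x) * x) / (s * m))"
    unfolding r k3 using cancel[of "x - q * y"] neq(3) by (simp add: mult_ac)
  \<comment> \<open>The numerator over the common denominator \<open>s^3 * d^2 * e * m\<close>: the
    first term lacks one \<open>d\<close>, the third lacks \<open>e\<close>.\<close>
  have id: "(t * x - y) * (t * (q * x) - y) * ((t * y - q * (q * x)) * ((x + y) * x)) * d +
    (t * x - y) * (q * x - t * y) * (t * x - y) * ((1 + q) * x * (q * x^2 - y^2)) +
    (x - t * y) * (t * x - y) * ((t * x - q * y) * (- (y + q * x) * x)) * e = 0"
    unfolding d_def e_def by algebra
  have comb: "a / (s * d) * (b / (s * e)) * (c / (s * m)) +
      a / (s * d) * (b' / (s * e)) * (a' / (s * d)) * (c' / m) +
      a'' / (s * d) * (b'' / (s * d)) * (c'' / (s * m)) =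
      (a * b * c * d + a * b' * a' * c' + a'' * b'' * c'' * e) / (s^3 * d^2 * e * m)"
    for a b c a' b' c' a'' b'' c''
    using nz(4) by (simp add: add_divide_distrib power2_eq_square power3_eq_cube mult_ac)
  show ?thesis
    unfolding T1 T3 unfolding r k2 comb id by simp
qed

context shift_system begin

definition "weight i j k = A i * G i (A j) * G i (G j (A k))"

lemma A_split3:
  assumes "i \<in> I" "j \<in> I" "k \<in> I" "i \<noteq> j" "i \<noteq> k" "j \<noteq> k"
  shows "A i = r (y i) (y j) * r (y i) (y k) * R {i, j, k} (y i)"
  unfolding mac_coeff_def
  using assms finite_I
  by (subst mac_prod_remove[of _ j], simp, simp, simp)
    (subst mac_prod_remove[of _ k], auto simp: insert_commute)

text \<open>Grouped by pairs of indices, the ratios form products as in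
  \<open>mac_ratio_mult\<close>, with the index of the earlier shift first; the remaining factor is
  symmetric in the three indices.\<close>

lemma weight_distinct:
  assumes "i \<in> I" "j \<in> I" "k \<in> I" "i \<noteq> j" "i \<noteq> k" "j \<noteq> k"
  defines "c \<equiv> cubic \<sigma>\<^sub>1 \<sigma>\<^sub>2"
  shows "weight i j k = - (q^3) * (c (y j) (y i) * c (y k) (y i) * c (y k) (y j)) /
    (antisym_denom q (y i) (y j) * antisym_denom q (y i) (y k) * antisym_denom q (y j) (y k)) *
    (R {i, j, k} (y i) * R {i, j, k} (y j) * R {i, j, k} (y k))"
proof -
  have A1: "A i = r (y i) (y j) * r (y i) (y k) * R {i, j, k} (y i)"
    by (rule A_split3) fact+
  have "A j = r (y j) (y i) * r (y j) (y k) * R {i, j, k} (y j)"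
    using A_split3[of j i k] assms by (simp add: insert_commute)
  then have A2: "G i (A j) = r (y j) (q * y i) * r (y j) (y k) * R {i, j, k} (y j)"
    using assms by (simp add: G_hom G_ratio G_prod G_y)
  have "A k = r (y k) (y i) * r (y k) (y j) * R {i, j, k} (y k)"
    using A_split3[of k i j] assms by (simp add: insert_commute)
  then have A3: "G i (G j (A k)) = r (y k) (q * y i) * r (y k) (q * y j) * R {i, j, k} (y k)"
    using assms by (simp add: G_hom G_ratio G_prod G_y G_q)
  have "weight i j k =
    (r (y i) (y j) * r (y j) (q * y i)) * (r (y i) (y k) * r (y k) (q * y i)) *
    (r (y j) (y k) * r (y k) (q * y j)) *
    (R {i, j, k} (y i) * R {i, j, k} (y j) * R {i, j, k} (y k))"
    unfolding weight_def A1 A2 A3 by (simp only: mult_ac)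
  also have "(r (y i) (y j) * r (y j) (q * y i)) * (r (y i) (y k) * r (y k) (q * y i)) *
    (r (y j) (y k) * r (y k) (q * y j)) = - (q^3) * (c (y j) (y i) * c (y k) (y i) * c (y k) (y j)) /
    (antisym_denom q (y i) (y j) * antisym_denom q (y i) (y k) * antisym_denom q (y j) (y k))"
    unfolding mac_ratio_mult[OF q_nonzero s_nonzero y_neq_q[OF assms(4)]]
      mac_ratio_mult[OF q_nonzero s_nonzero y_neq_q[OF assms(5)]]
      mac_ratio_mult[OF q_nonzero s_nonzero y_neq_q[OF assms(6)]] c_def
    by (simp add: power3_eq_cube mult_ac)
  finally show ?thesis .
qed

text \<open>Up to the sign of the permutation, all six terms share their denominators and the
  product over the other indices. These are collected in \<open>K\<close>, and
  \<open>cubic_serre\<close> remains.\<close>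

lemma weight_serre_distinct:
  assumes "i \<in> I" "j \<in> I" "k \<in> I" "i \<noteq> j" "i \<noteq> k" "j \<noteq> k"
  defines "\<kappa> \<equiv> \<lambda>i j k. serre_factor (y i) (y j) (y k)"
  shows "weight i j k * \<kappa> i j k + weight i k j * \<kappa> i k j + weight j i k * \<kappa> j i k +
    weight j k i * \<kappa> j k i + weight k i j * \<kappa> k i j + weight k j i * \<kappa> k j i = 0"
proof -
  define c where "c = cubic \<sigma>\<^sub>1 \<sigma>\<^sub>2"
  define S where "S = R {i, j, k} (y i) * R {i, j, k} (y j) * R {i, j, k} (y k)"
  define m where "m = y i * y j * y k"
  define V where "V = antisym_denom q (y i) (y j) * antisym_denom q (y i) (y k) * antisym_denom q (y j) (y k)"
  define h where "h = (\<lambda>i j k. (y i + y k) * (y i * y k - (y j)^2))"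
  have \<kappa>: "\<kappa> i j k = h i j k / m" "\<kappa> i k j = h i k j / m" "\<kappa> j i k = h j i k / m"
    "\<kappa> j k i = h j k i / m" "\<kappa> k i j = h k i j / m" "\<kappa> k j i = h k j i / m"
    unfolding \<kappa>_def m_def h_def by (simp_all add: serre_factor_eq y_nonzero mult_ac)
  have sw: "antisym_denom q (y j) (y i) = - antisym_denom q (y i) (y j)" "antisym_denom q (y k) (y i) = - antisym_denom q (y i) (y k)"
    "antisym_denom q (y k) (y j) = - antisym_denom q (y j) (y k)"
    by (rule antisym_denom_swap)+
  have V: "antisym_denom q (y i) (y j) * antisym_denom q (y i) (y k) * antisym_denom q (y j) (y k) = V"
    "antisym_denom q (y i) (y k) * antisym_denom q (y i) (y j) * antisym_denom q (y k) (y j) = - V"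
    "antisym_denom q (y j) (y i) * antisym_denom q (y j) (y k) * antisym_denom q (y i) (y k) = - V"
    "antisym_denom q (y j) (y k) * antisym_denom q (y j) (y i) * antisym_denom q (y k) (y i) = V"
    "antisym_denom q (y k) (y i) * antisym_denom q (y k) (y j) * antisym_denom q (y i) (y j) = V"
    "antisym_denom q (y k) (y j) * antisym_denom q (y k) (y i) * antisym_denom q (y j) (y i) = - V"
    unfolding V_def sw by (simp_all add: mult_ac)
  have S: "R {i, j, k} (y i) * R {i, j, k} (y j) * R {i, j, k} (y k) = S"
    "R {i, k, j} (y i) * R {i, k, j} (y k) * R {i, k, j} (y j) = S"
    "R {j, i, k} (y j) * R {j, i, k} (y i) * R {j, i, k} (y k) = S"
    "R {j, k, i} (y j) * R {j, k, i} (y k) * R {j, k, i} (y i) = S"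
    "R {k, i, j} (y k) * R {k, i, j} (y i) * R {k, i, j} (y j) = S"
    "R {k, j, i} (y k) * R {k, j, i} (y j) * R {k, j, i} (y i) = S"
    unfolding S_def by (simp_all add: insert_commute mult_ac)
  have Z: "h i j k * c (y j) (y i) * c (y k) (y i) * c (y k) (y j) -
    h j i k * c (y i) (y j) * c (y k) (y j) * c (y k) (y i) -
    h i k j * c (y k) (y i) * c (y j) (y i) * c (y j) (y k) +
    h j k i * c (y k) (y j) * c (y i) (y j) * c (y i) (y k) +
    h k i j * c (y i) (y k) * c (y j) (y k) * c (y j) (y i) -
    h k j i * c (y j) (y k) * c (y i) (y k) * c (y i) (y j) = 0" (is "?Z = 0")
    \<comment> \<open>In the unfolded \<open>cubic_serre\<close> the variables occur in the order
      \<open>u\<close>, \<open>w\<close>, \<open>v\<close>, hence \<open>y k\<close> before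
      \<open>y j\<close>.\<close>
    using cubic_serre[of "y i" "y k" "y j" \<sigma>\<^sub>1 \<sigma>\<^sub>2] unfolding c_def h_def .
  define K where "K = - (q^3) / V * S / m"
  have W: "weight i j k * \<kappa> i j k = K * (h i j k * c (y j) (y i) * c (y k) (y i) * c (y k) (y j))"
    "weight j i k * \<kappa> j i k = - (K * (h j i k * c (y i) (y j) * c (y k) (y j) * c (y k) (y i)))"
    "weight i k j * \<kappa> i k j = - (K * (h i k j * c (y k) (y i) * c (y j) (y i) * c (y j) (y k)))"
    "weight j k i * \<kappa> j k i = K * (h j k i * c (y k) (y j) * c (y i) (y j) * c (y i) (y k))"
    "weight k i j * \<kappa> k i j = K * (h k i j * c (y i) (y k) * c (y j) (y k) * c (y j) (y i))"
    "weight k j i * \<kappa> k j i = - (K * (h k j i * c (y j) (y k) * c (y i) (y k) * c (y i) (y j)))"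
    using weight_distinct[of i j k] weight_distinct[of i k j] weight_distinct[of j i k]
      weight_distinct[of j k i] weight_distinct[of k i j] weight_distinct[of k j i] assms(1-6)
    unfolding V S \<kappa> c_def[symmetric] K_def by (simp_all add: mult_ac)
  have "weight i j k * \<kappa> i j k + weight i k j * \<kappa> i k j + weight j i k * \<kappa> j i k +
    weight j k i * \<kappa> j k i + weight k i j * \<kappa> k i j + weight k j i * \<kappa> k j i = K * ?Z"
    unfolding W by (simp add: algebra_simps)
  then show ?thesis
    unfolding Z by simp
qed

lemma weight_serre_two:
  assumes "i \<in> I" "k \<in> I" "i \<noteq> k"
  shows "weight i i k * serre_factor (y i) (q * y i) (y k) +
    weight i k i * serre_factor (y i) (y k) (q * y i) +
    weight k i i * serre_factor (y k) (y i) (q * y i) = 0"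
proof -
  let ?T = "{i, k}"
  define S where "S = R ?T (y i) * R ?T (q * y i) * R ?T (y k)"
  have Ai: "A i = r (y i) (y k) * R ?T (y i)"
    by (rule A_split) fact+
  have Ak: "A k = r (y k) (y i) * R ?T (y k)"
    using A_split[of k i] assms by (simp add: insert_commute)
  note hom = G_hom G_ratio G_prod G_y G_q
  have "weight i i k = r (y i) (y k) * r (q * y i) (y k) * r (y k) (q * (q * y i)) * S"
    "weight i k i = r (y i) (y k) * r (y k) (q * y i) * r (q * y i) (q * y k) * S"
    "weight k i i = r (y k) (y i) * r (y i) (q * y k) * r (q * y i) (q * y k) * S"
    unfolding weight_def Ai Ak S_def using assms by (simp_all add: hom mult_ac)
  then have "weight i i k * serre_factor (y i) (q * y i) (y k) +
    weight i k i * serre_factor (y i) (y k) (q * y i) +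
    weight k i i * serre_factor (y k) (y i) (q * y i) =
    S * (r (y i) (y k) * r (q * y i) (y k) * r (y k) (q * (q * y i)) * serre_factor (y i) (q * y i) (y k) +
    r (y i) (y k) * r (y k) (q * y i) * r (q * y i) (q * y k) * serre_factor (y i) (y k) (q * y i) +
    r (y k) (y i) * r (y i) (q * y k) * r (q * y i) (q * y k) * serre_factor (y k) (y i) (q * y i))"
    by (simp add: distrib_left mult_ac)
  \<comment> \<open>This pole is excluded by injectivity: \<open>G i\<close> fixes
    \<open>y k\<close> and maps \<open>q * y i\<close> to \<open>q * (q * y i)\<close>, so equality
    would force \<open>y k = q * y i\<close>.\<close>
  also have "y k \<noteq> q * (q * y i)"
  proof
    assume "y k = q * (q * y i)"
    moreover have "G i (y k) = y k" "G i (q * y i) = q * (q * y i)"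
      using assms by (simp_all add: hom)
    ultimately have "G i (y k) = G i (q * y i)"
      by simp
    then show False
      using y_neq_q[OF assms(3)[symmetric]] by (simp only: field_endo.inj[OF endo])
  qed
  then have "r (y i) (y k) * r (q * y i) (y k) * r (y k) (q * (q * y i)) * serre_factor (y i) (q * y i) (y k) +
    r (y i) (y k) * r (y k) (q * y i) * r (q * y i) (q * y k) * serre_factor (y i) (y k) (q * y i) +
    r (y k) (y i) * r (y i) (q * y k) * r (q * y i) (q * y k) * serre_factor (y k) (y i) (q * y i) = 0"
    by (rule mac_ratio_serre[OF y_nonzero y_nonzero q_nonzero s_nonzero y_neq[OF assms(3)]
        y_neq_q[OF assms(3)[symmetric]] y_neq_q[OF assms(3)]])
  finally show ?thesis
    by simp
qed

definition "E_bracket l m n f =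
  (E l (E m (E n f) - E n (E m f)) - (E m (E n (E l f)) - E n (E m (E l f))))"

definition "bracket_monomial l m n u v w =
  u powi l * v powi m * w powi n - u powi l * v powi n * w powi m -
  u powi m * v powi n * w powi l + u powi n * v powi m * w powi (l::int)" for u v w :: 'a

lemma E_bracket_eq:
  "E_bracket l m n f = C^3 * (\<Sum>i\<in>I. \<Sum>j\<in>I. \<Sum>k\<in>I. weight i j k *
    bracket_monomial l m n (y i) (G i (y j)) (G i (G j (y k))) * G i (G j (G k f)))"
  unfolding E_bracket_def E_diff E_E_E weight_def[symmetric] bracket_monomial_def
  by (simp add: algebra_simps sum.distrib sum_subtractf)

text \<open>The index pattern \<open>b - 1\<close>, \<open>c + 1\<close> is the effect of
  multiplying by z_2 / z_3. Summed over the permutations of the exponents, the bracket monomials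
  become \<open>serre_factor\<close> times the symmetric Laurent polynomial \<open>M\<close>, after
  which triples can be grouped by which of their indices coincide.\<close>

lemma serre_relation:
  "E_bracket a (b - 1) (c + 1) f + E_bracket a (c - 1) (b + 1) f + E_bracket b (a - 1) (c + 1) f +
   E_bracket b (c - 1) (a + 1) f + E_bracket c (a - 1) (b + 1) f + E_bracket c (b - 1) (a + 1) f = 0"
proof -
  define M where "M = (\<lambda>u v w :: 'a. u powi a * v powi b * w powi c + u powi a * v powi c * w powi b +
    u powi b * v powi a * w powi c + u powi b * v powi c * w powi a +
    u powi c * v powi a * w powi b + u powi c * v powi b * w powi a)"
  define F where "F = (\<lambda>i j k. weight i j k * (serre_factor (y i) (G i (y j)) (G i (G j (y k))) *
    M (y i) (G i (y j)) (G i (G j (y k)))) * G i (G j (G k f)))"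
  have M_swap: "M v u w = M u v w" "M u w v = M u v w" for u v w
    unfolding M_def by (simp_all only: mult_ac add_ac)
  have nz: "y i \<noteq> 0" "G i (y j) \<noteq> 0" "G i (G j (y k)) \<noteq> 0" for i j k
    using y_nonzero field_endo.nonzero[OF endo] by auto
  have two: "F i i k + F i k i + F k i i = 0" if "i \<in> I" "k \<in> I" "i \<noteq> k" for i k
  proof -
    have M_eq: "M (y i) (y k) (q * y i) = M (y i) (q * y i) (y k)"
      "M (y k) (y i) (q * y i) = M (y i) (q * y i) (y k)"
      using M_swap by metis+
    have "F i i k + F i k i + F k i i = (weight i i k * serre_factor (y i) (q * y i) (y k) +
      weight i k i * serre_factor (y i) (y k) (q * y i) +
      weight k i i * serre_factor (y k) (y i) (q * y i)) * (M (y i) (q * y i) (y k) * G i (G i (G k f)))"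
      using that(3) unfolding F_def
      by (simp add: G_y G_q G_hom(2) M_eq G_commute[of k i] algebra_simps)
    with weight_serre_two[OF that] show ?thesis
      by simp
  qed
  have "(\<Sum>i\<in>I. \<Sum>j\<in>I. \<Sum>k\<in>I. F i j k) = 0"
  proof (rule sum_triples_symmetrized[OF six_nonzero])
    fix i j k assume ijk: "i \<in> I" "j \<in> I" "k \<in> I"
    consider "i = j" "j = k" | "i = j" "j \<noteq> k" | "i = k" "j \<noteq> k" | "j = k" "i \<noteq> k"
      | "i \<noteq> j" "i \<noteq> k" "j \<noteq> k" by metis
    then show "F i j k + F i k j + F j i k + F j k i + F k i j + F k j i = 0"
    proof cases
      \<comment> \<open>The three arguments are in geometric progression, so the factor
        \<open>u * w - v^2\<close> of \<open>serre_factor\<close> vanishes.\<close>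
      case 1
      have "serre_factor (y i) (q * y i) (q * (q * y i)) = 0"
        by (simp add: serre_factor_eq y_nonzero q_nonzero power2_eq_square)
      with 1 show ?thesis
        by (simp add: F_def G_y G_hom G_q)
    next
      \<comment> \<open>With exactly two equal indices, here and in the next two cases, the six
        permutations produce each position of the odd index twice.\<close>
      case 2
      then have "F i j k + F i k j + F j i k + F j k i + F k i j + F k j i = (F i i k + F i k i + F k i i) + (F i i k + F i k i + F k i i)"
        by (simp add: add_ac)
      with 2 two[OF ijk(1,3)] show ?thesis by simp
    next
      case 3
      then have "F i j k + F i k j + F j i k + F j k i + F k i j + F k j i = (F i i j + F i j i + F j i i) + (F i i j + F i j i + F j i i)"
        by (simp add: add_ac)
      with 3 two[OF ijk(1,2)] show ?thesis by simp
    next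
      case 4
      then have "F i j k + F i k j + F j i k + F j k i + F k i j + F k j i = (F j j i + F j i j + F i j j) + (F j j i + F j i j + F i j j)"
        by (simp add: add_ac)
      with 4 two[OF ijk(2,1)] show ?thesis by simp
    next
      case 5
      have M_eq: "M (y i) (y k) (y j) = M (y i) (y j) (y k)" "M (y j) (y i) (y k) = M (y i) (y j) (y k)"
        "M (y j) (y k) (y i) = M (y i) (y j) (y k)" "M (y k) (y i) (y j) = M (y i) (y j) (y k)"
        "M (y k) (y j) (y i) = M (y i) (y j) (y k)"
        using M_swap by metis+
      have G_eq: "G i (G k (G j f)) = G i (G j (G k f))" "G j (G i (G k f)) = G i (G j (G k f))"
        "G j (G k (G i f)) = G i (G j (G k f))" "G k (G i (G j f)) = G i (G j (G k f))"
        "G k (G j (G i f)) = G i (G j (G k f))"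
        using G_commute by metis+
      have G_y': "G i (y j) = y j" "G i (y k) = y k" "G j (y i) = y i" "G j (y k) = y k"
        "G k (y i) = y i" "G k (y j) = y j"
        using 5 by (simp_all add: G_y)
      have "F i j k + F i k j + F j i k + F j k i + F k i j + F k j i =
        (weight i j k * serre_factor (y i) (y j) (y k) + weight i k j * serre_factor (y i) (y k) (y j) +
         weight j i k * serre_factor (y j) (y i) (y k) + weight j k i * serre_factor (y j) (y k) (y i) +
         weight k i j * serre_factor (y k) (y i) (y j) + weight k j i * serre_factor (y k) (y j) (y i)) *
        (M (y i) (y j) (y k) * G i (G j (G k f)))"
        unfolding F_def G_y' M_eq G_eq by (simp only: distrib_right mult.assoc mult.left_commute mult.commute distrib_left)
      with weight_serre_distinct[OF ijk 5] show ?thesis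
        by simp
    qed
  qed
  moreover have "serre_factor u v w * M u v w =
      bracket_monomial a (b - 1) (c + 1) u v w + bracket_monomial a (c - 1) (b + 1) u v w +
      bracket_monomial b (a - 1) (c + 1) u v w + bracket_monomial b (c - 1) (a + 1) u v w +
      bracket_monomial c (a - 1) (b + 1) u v w + bracket_monomial c (b - 1) (a + 1) u v w"
    if "u \<noteq> 0" "v \<noteq> 0" "w \<noteq> 0" for u v w
  proof -
    have powi: "x powi (n - 1) = x powi n * inverse x" "x powi (n + 1) = x powi n * x"
      if "x \<noteq> 0" for x :: 'a and n
      using that by (simp_all add: power_int_diff power_int_add divide_inverse)
    show ?thesis
      unfolding powi[OF that(1)] powi[OF that(2)] powi[OF that(3)] M_def serre_factor_def divide_inverse
        bracket_monomial_def
      by (simp add: algebra_simps)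
  qed
  note kM = this[OF nz]
  then have "E_bracket a (b - 1) (c + 1) f + E_bracket a (c - 1) (b + 1) f + E_bracket b (a - 1) (c + 1) f +
   E_bracket b (c - 1) (a + 1) f + E_bracket c (a - 1) (b + 1) f + E_bracket c (b - 1) (a + 1) f =
    C^3 * (\<Sum>i\<in>I. \<Sum>j\<in>I. \<Sum>k\<in>I. F i j k)"
    unfolding E_bracket_eq F_def kM by (simp only: distrib_left distrib_right sum.distrib)
  ultimately show ?thesis
    by simp
qed

end

section \<open>The series \<open>\<psi>\<close> and its partial fractions\<close>

definition fps_lin :: "'a::field \<Rightarrow> 'a fps" where "fps_lin c = 1 - fps_const c * fps_X"

lemma fps_lin_nth_0 [simp]: "fps_nth (fps_lin c) 0 = 1"
  by (simp add: fps_lin_def)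

lemma fps_lin_nonzero [simp]: "fps_lin c \<noteq> 0"
  by (metis fps_lin_nth_0 fps_zero_nth zero_neq_one)

lemma fps_divide_mult_cancel:
  fixes f g :: "'a::field fps"
  shows "fps_nth g 0 \<noteq> 0 \<Longrightarrow> f / g * g = f"
  by (metis dvd_div_mult_self fps_is_unit_iff unit_imp_dvd)

text \<open>Extended by 0 to negative indices, so that the recurrences between coefficients hold at
  every integer without boundary cases.\<close>

definition fps_coeff_int :: "'a::zero fps \<Rightarrow> int \<Rightarrow> 'a" where
  "fps_coeff_int F n = (if n \<ge> 0 then fps_nth F (nat n) else 0)"

lemma fps_coeff_int_mult_lin:
  "fps_coeff_int (F * fps_lin c) n = fps_coeff_int F n - c * fps_coeff_int F (n - 1)"
proof -
  have *: "F * fps_lin c = F - fps_const c * (F * fps_X)"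
    by (simp add: fps_lin_def algebra_simps)
  consider "n < 0" | "n = 0" | "n > 0" by linarith
  then show ?thesis
    by cases (auto simp: fps_coeff_int_def * nat_diff_distrib)
qed

lemma fps_coeff_int_mult_lin3:
  "fps_coeff_int (F * (fps_lin a * fps_lin b * fps_lin c)) n = fps_coeff_int F n -
    (a + b + c) * fps_coeff_int F (n - 1) + (a * b + a * c + b * c) * fps_coeff_int F (n - 2) -
    a * b * c * fps_coeff_int F (n - 3)"
  unfolding mult.assoc[symmetric] fps_coeff_int_mult_lin by (simp add: algebra_simps)

definition fps_map :: "('a::zero \<Rightarrow> 'a) \<Rightarrow> 'a fps \<Rightarrow> 'a fps" where
  "fps_map \<phi> F = Abs_fps (\<lambda>n. \<phi> (fps_nth F n))"

context field_endo begin

lemma fps_map_mult: "fps_map \<phi> (F * F') = fps_map \<phi> F * fps_map \<phi> F'"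
  by (simp add: fps_map_def fps_eq_iff fps_mult_nth sum mult)

lemma fps_map_lin: "fps_map \<phi> (fps_lin c) = fps_lin (\<phi> c)"
  by (auto simp: fps_map_def fps_eq_iff fps_lin_def diff mult zero one fps_X_def)

lemma fps_map_divide:
  assumes "fps_nth D 0 = 1"
  shows "fps_map \<phi> (F / D) = fps_map \<phi> F / fps_map \<phi> D"
proof -
  have "fps_nth (fps_map \<phi> D) 0 = 1"
    by (simp add: fps_map_def assms one)
  then have D: "fps_map \<phi> D \<noteq> 0" "fps_nth (fps_map \<phi> D) 0 \<noteq> 0"
    by auto
  have "fps_map \<phi> (F / D) * fps_map \<phi> D = fps_map \<phi> F"
    unfolding fps_map_mult[symmetric] using assms by (simp add: fps_divide_mult_cancel)
  also have "\<dots> = fps_map \<phi> F / fps_map \<phi> D * fps_map \<phi> D"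
    by (simp add: fps_divide_mult_cancel D)
  finally show ?thesis
    using D(1) by simp
qed

lemma fps_map_one: "fps_map \<phi> 1 = 1"
  by (simp add: fps_map_def fps_eq_iff zero one)

lemma fps_map_prod: "fps_map \<phi> (\<Prod>i\<in>S. F i) = (\<Prod>i\<in>S. fps_map \<phi> (F i))"
  by (induction S rule: infinite_finite_induct) (simp_all add: fps_map_mult fps_map_one)

lemma fps_coeff_int_map: "fps_coeff_int (fps_map \<phi> F) n = \<phi> (fps_coeff_int F n)"
  by (simp add: fps_coeff_int_def fps_map_def zero)

end

text \<open>
  Written in \<open>u\<^sub>i = q\<^sup>1\<^sup>/\<^sup>2 x\<^sub>i\<close> this is \<open>\<psi>\<^sup>+\<close> as a series in \<open>z\<close>; with \<open>q / u\<^sub>i\<close> in place of \<open>u\<^sub>i\<close> it is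
  \<open>\<psi>\<^sup>-\<close> as a series in \<open>z\<^sup>-\<^sup>1\<close>.
\<close>

definition psi_series :: "'i set \<Rightarrow> 'a::field \<Rightarrow> 'a \<Rightarrow> ('i \<Rightarrow> 'a) \<Rightarrow> 'a fps" where
  "psi_series I q t u = (\<Prod>i\<in>I. fps_lin (t / q * u i) * fps_lin (u i / t) / (fps_lin (u i) * fps_lin (u i / q)))"

lemma (in field_endo) fps_map_psi_series:
  "\<phi> q = q \<Longrightarrow> \<phi> t = t \<Longrightarrow> fps_map \<phi> (psi_series I q t u) = psi_series I q t (\<lambda>i. \<phi> (u i))"
  by (simp add: psi_series_def fps_map_prod fps_map_divide fps_map_mult fps_map_lin mult divide)

text \<open>Only the i-th factor changes, and its old and new form share the denominator
  \<open>fps_lin (u i)\<close>. With w = 1 / \<open>u i\<close> the two cubic products are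
  \<open>(u i)^3\<close> g(w,z) and \<open>- (u i)^3\<close> g(z,w), so this is the relation between
  psi and one shift before coefficients are taken.\<close>

lemma psi_series_shift:
  assumes "finite I" "i \<in> I" "q \<noteq> 0" "t \<noteq> 0" "\<And>j. j \<in> I - {i} \<Longrightarrow> u' j = u j" "u' i = q * u i"
  shows "psi_series I q t u' * (fps_lin (q * u i) * fps_lin (t / q * u i) * fps_lin (u i / t)) =
    psi_series I q t u * (fps_lin (t * u i) * fps_lin (q / t * u i) * fps_lin (u i / q))"
proof -
  define F where "F = fps_lin (t / q * u i) * fps_lin (u i / t) / (fps_lin (u i) * fps_lin (u i / q))"
  define F' where "F' = fps_lin (t / q * u' i) * fps_lin (u' i / t) / (fps_lin (u' i) * fps_lin (u' i / q))"
  define P where "P = psi_series (I - {i}) q t u"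
  have P: "psi_series (I - {i}) q t u' = P"
    unfolding P_def psi_series_def using assms(5) by (intro prod.cong) auto
  have u: "psi_series I q t u = F * P"
    unfolding psi_series_def P_def F_def by (rule prod.remove) fact+
  have u': "psi_series I q t u' = F' * P"
    unfolding P[symmetric] unfolding psi_series_def F'_def by (rule prod.remove) fact+
  have F: "F * (fps_lin (u i) * fps_lin (u i / q)) = fps_lin (t / q * u i) * fps_lin (u i / t)"
    unfolding F_def by (rule fps_divide_mult_cancel) simp
  have "F' * (fps_lin (u' i) * fps_lin (u' i / q)) = fps_lin (t / q * u' i) * fps_lin (u' i / t)"
    unfolding F'_def by (rule fps_divide_mult_cancel) simp
  then have F': "F' * (fps_lin (q * u i) * fps_lin (u i)) = fps_lin (t * u i) * fps_lin (q / t * u i)"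
    using assms(3,4,6) by simp
  have "F' * (fps_lin (q * u i) * fps_lin (t / q * u i) * fps_lin (u i / t)) * fps_lin (u i) =
    F' * (fps_lin (q * u i) * fps_lin (u i)) * (fps_lin (t / q * u i) * fps_lin (u i / t))"
    by (simp only: mult_ac)
  also have "\<dots> = F * (fps_lin (u i) * fps_lin (u i / q)) * (fps_lin (t * u i) * fps_lin (q / t * u i))"
    unfolding F F' by (simp only: mult_ac)
  also have "\<dots> = F * (fps_lin (t * u i) * fps_lin (q / t * u i) * fps_lin (u i / q)) * fps_lin (u i)"
    by (simp only: mult_ac)
  finally have "F' * (fps_lin (q * u i) * fps_lin (t / q * u i) * fps_lin (u i / t)) =
      F * (fps_lin (t * u i) * fps_lin (q / t * u i) * fps_lin (u i / q))"
    by simp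
  then have "F' * (fps_lin (q * u i) * fps_lin (t / q * u i) * fps_lin (u i / t)) * P =
      F * (fps_lin (t * u i) * fps_lin (q / t * u i) * fps_lin (u i / q)) * P"
    by (rule arg_cong)
  then show ?thesis
    unfolding u u' by (simp only: mult_ac)
qed

lemma coef_sums:
  assumes "q \<noteq> 0" "t \<noteq> (0::'a::field)"
  shows "q * v + t / q * v + v / t = gcoef1 q t * v"
    "q * v * (t / q * v) + q * v * (v / t) + t / q * v * (v / t) = gcoef2 q t * v^2"
    "q * v * (t / q * v) * (v / t) = v^3"
    "t * v + q / t * v + v / q = gcoef2 q t * v"
    "t * v * (q / t * v) + t * v * (v / q) + q / t * v * (v / q) = gcoef1 q t * v^2"
    "t * v * (q / t * v) * (v / q) = v^3"
  using assms
  by (simp_all add: gcoef1_def gcoef2_def power2_eq_square power3_eq_cube algebra_simps)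

lemma psi_series_recurrence:
  assumes "finite I" "i \<in> I" "q \<noteq> 0" "t \<noteq> 0" "\<And>j. j \<in> I - {i} \<Longrightarrow> u' j = u j" "u' i = q * u i"
  defines "p \<equiv> fps_coeff_int (psi_series I q t u)" and "p' \<equiv> fps_coeff_int (psi_series I q t u')"
  shows "p' n - gcoef1 q t * u i * p' (n - 1) + gcoef2 q t * (u i)^2 * p' (n - 2) - (u i)^3 * p' (n - 3) =
    p n - gcoef2 q t * u i * p (n - 1) + gcoef1 q t * (u i)^2 * p (n - 2) - (u i)^3 * p (n - 3)"
  using arg_cong[OF psi_series_shift[of I i q t u' u, OF assms(1-6)], of "\<lambda>F. fps_coeff_int F n"]
  unfolding fps_coeff_int_mult_lin3 coef_sums[OF assms(3,4)] p_def p'_def .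

lemma psi_series_recurrence_inverse:
  assumes "finite I" "i \<in> I" "q \<noteq> 0" "t \<noteq> 0" "\<And>j. j \<in> I - {i} \<Longrightarrow> u' j = u j"
    "u' i = q * u i" "u i \<noteq> 0"
  defines "p \<equiv> \<lambda>n. fps_coeff_int (psi_series I q t (\<lambda>i. q / u i)) (- n)"
    and "p' \<equiv> \<lambda>n. fps_coeff_int (psi_series I q t (\<lambda>i. q / u' i)) (- n)"
  shows "p' n - gcoef1 q t * u i * p' (n - 1) + gcoef2 q t * (u i)^2 * p' (n - 2) - (u i)^3 * p' (n - 3) =
    p n - gcoef2 q t * u i * p (n - 1) + gcoef1 q t * (u i)^2 * p (n - 2) - (u i)^3 * p (n - 3)"
proof -
  have "p (n - 3) - gcoef1 q t * (1 / u i) * p (n - 2) + gcoef2 q t * (1 / u i)^2 * p (n - 1) - (1 / u i)^3 * p n =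
    p' (n - 3) - gcoef2 q t * (1 / u i) * p' (n - 2) + gcoef1 q t * (1 / u i)^2 * p' (n - 1) - (1 / u i)^3 * p' n"
    \<comment> \<open>Inversion reverses the shift: \<open>q / u i = q * (q / u' i)\<close>. Hence
      \<open>u\<close> and \<open>u'\<close> change places, and the coefficients are traversed
      backwards, starting from index \<open>- (n - 3)\<close>.\<close>
    using psi_series_recurrence[OF assms(1-4), of "\<lambda>j. q / u j" "\<lambda>j. q / u' j" "- (n - 3)"] assms(3-7)
    unfolding p_def p'_def by (simp add: algebra_simps)
  then have "(u i)^3 * (p (n - 3) - gcoef1 q t * (1 / u i) * p (n - 2) + gcoef2 q t * (1 / u i)^2 * p (n - 1) - (1 / u i)^3 * p n) =
    (u i)^3 * (p' (n - 3) - gcoef2 q t * (1 / u i) * p' (n - 2) + gcoef1 q t * (1 / u i)^2 * p' (n - 1) - (1 / u i)^3 * p' n)"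
    by simp
  moreover have "(u i)^3 * (a - b * (1 / u i) * c + d * (1 / u i)^2 * e - (1 / u i)^3 * f) =
    (u i)^3 * a - b * (u i)^2 * c + d * u i * e - f" for a b c d e f
    using assms(7) by (simp add: power2_eq_square power3_eq_cube field_simps)
  ultimately have "(u i)^3 * p (n - 3) - gcoef1 q t * (u i)^2 * p (n - 2) + gcoef2 q t * u i * p (n - 1) - p n =
    (u i)^3 * p' (n - 3) - gcoef2 q t * (u i)^2 * p' (n - 2) + gcoef1 q t * u i * p' (n - 1) - p' n"
    by (simp only:)
  then show ?thesis
    by algebra
qed

section \<open>Partial fraction decomposition of psi\<close>

lemma degree_prod_linear: "degree (\<Prod>p\<in>S. [:1, - a p:]) \<le> card S"
  for a :: "'i \<Rightarrow> 'a::field"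
proof (induction S rule: infinite_finite_induct)
  case (insert x S)
  have "degree ([:1, - a x:] * (\<Prod>p\<in>S. [:1, - a p:])) \<le> 1 + card S"
    by (rule order_trans[OF degree_mult_le add_mono]) (use insert in auto)
  with insert show ?case by simp
qed auto

lemma coeff_prod_linear: "finite S \<Longrightarrow> coeff (\<Prod>p\<in>S. [:1, - a p:]) (card S) = (\<Prod>p\<in>S. - a p)"
  for a :: "'i \<Rightarrow> 'a::field"
proof (induction S rule: finite_induct)
  case (insert x S)
  have "coeff (\<Prod>p\<in>S. [:1, - a p:]) (Suc (card S)) = 0"
    using degree_prod_linear[of a S] by (intro coeff_eq_0) simp
  with insert show ?case by simp
qed auto

text \<open>Interpolation: both sides have degree at most \<open>card S\<close>, agree at the
  \<open>card S\<close> points \<open>1 / b p\<close>, where only one term on the right survives,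
  and have the same coefficient in degree \<open>card S\<close> by \<open>prod_eq\<close>. After
  division by the product of the \<open>[:1, - b p:]\<close>, the polynomial part of the
  decomposition is therefore 1.\<close>

lemma partial_fraction_poly:
  fixes a b :: "'i \<Rightarrow> 'a::field"
  assumes S: "finite S" and inj: "inj_on b S" and nz: "\<And>p. p \<in> S \<Longrightarrow> b p \<noteq> 0"
    and prod_eq: "(\<Prod>p\<in>S. a p) = (\<Prod>p\<in>S. b p)"
  defines "c \<equiv> \<lambda>p. (\<Prod>r\<in>S. 1 - a r / b p) / (\<Prod>r\<in>S - {p}. 1 - b r / b p)"
  shows "(\<Prod>p\<in>S. [:1, - a p:]) =
    (\<Prod>p\<in>S. [:1, - b p:]) + (\<Sum>p\<in>S. [:c p:] * (\<Prod>r\<in>S - {p}. [:1, - b r:]))"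
    (is "?P = ?Q + ?R")
proof (rule poly_eqI_degree_lead_coeff[where n = "card S" and A = "(\<lambda>p. 1 / b p) ` S"])
  have deg: "degree ([:c p:] * (\<Prod>r\<in>S - {p}. [:1, - b r:])) < card S" if "p \<in> S" for p
  proof -
    have "degree ([:c p:] * (\<Prod>r\<in>S - {p}. [:1, - b r:])) \<le> 0 + card (S - {p})"
      by (rule order_trans[OF degree_mult_le add_mono]) (use degree_prod_linear in auto)
    also have "card (S - {p}) < card S"
      using that S by (meson card_Diff1_less)
    finally show ?thesis by simp
  qed
  have "coeff ?R (card S) = 0"
    unfolding coeff_sum using deg by (intro sum.neutral ballI coeff_eq_0)
  then show "coeff ?P (card S) = coeff (?Q + ?R) (card S)"
    using prod_eq S by (simp add: coeff_prod_linear prod_uminus)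
  show "degree ?P \<le> card S"
    by (rule degree_prod_linear)
  show "degree (?Q + ?R) \<le> card S"
    using deg by (intro degree_add_le degree_prod_linear degree_sum_le S less_imp_le)
  have "inj_on (\<lambda>p. 1 / b p) S"
    using inj nz by (auto simp: inj_on_def)
  then show "card S \<le> card ((\<lambda>p. 1 / b p) ` S)"
    by (simp add: card_image)
next
  fix z assume "z \<in> (\<lambda>p. 1 / b p) ` S"
  then obtain p where p: "p \<in> S" "z = 1 / b p" by auto
  have 0: "(\<Prod>r\<in>T. 1 - b r / b p) = 0" if "p \<in> T" "T \<subseteq> S" for T
    using that nz p(1) S finite_subset by (intro prod_zero bexI[of _ p]) auto
  have nz': "(\<Prod>r\<in>S - {p}. 1 - b r / b p) \<noteq> 0"
    using inj nz p(1) S by (auto simp: inj_on_def)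
  have "poly ?R z = (\<Sum>r\<in>S. c r * (\<Prod>r'\<in>S - {r}. 1 - b r' / b p))"
    by (simp add: poly_sum poly_prod p)
  also have "\<dots> = (\<Sum>r\<in>{p}. c r * (\<Prod>r'\<in>S - {r}. 1 - b r' / b p))"
    using p(1) S nz by (intro sum.mono_neutral_right) (auto intro!: 0)
  also have "\<dots> = (\<Prod>r\<in>S. 1 - a r / b p)"
    using nz' by (simp add: c_def)
  finally show "poly ?P z = poly (?Q + ?R) z"
    using 0[OF p(1)] by (simp add: poly_prod p)
qed

lemma partial_fraction_fps:
  fixes a b :: "'i \<Rightarrow> 'a::field" and F :: "'a fps"
  assumes S: "finite S" and inj: "inj_on b S" and nz: "\<And>p. p \<in> S \<Longrightarrow> b p \<noteq> 0"
    and prod_eq: "(\<Prod>p\<in>S. a p) = (\<Prod>p\<in>S. b p)"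
    and F: "F * (\<Prod>p\<in>S. fps_lin (b p)) = (\<Prod>p\<in>S. fps_lin (a p))"
  shows "fps_nth F n = (if n = 0 then 1 else 0) +
    (\<Sum>p\<in>S. (\<Prod>r\<in>S. 1 - a r / b p) / (\<Prod>r\<in>S - {p}. 1 - b r / b p) * b p ^ n)"
proof -
  define c where "c = (\<lambda>p. (\<Prod>r\<in>S. 1 - a r / b p) / (\<Prod>r\<in>S - {p}. 1 - b r / b p))"
  define geo :: "'a \<Rightarrow> 'a fps" where "geo = (\<lambda>d. Abs_fps (\<lambda>n. d ^ n))"
  define D where "D = (\<Prod>p\<in>S. fps_lin (b p))"
  have fps_lin: "fps_of_poly [:1, - d:] = fps_lin d" for d :: 'a
    by (simp add: fps_lin_def fps_of_poly_pCons fps_eq_iff)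
  have geo: "geo d * fps_lin d = 1" for d
  proof (rule fps_ext)
    fix n show "fps_nth (geo d * fps_lin d) n = fps_nth 1 n"
      by (cases n) (simp_all add: geo_def fps_lin_def right_diff_distrib mult.left_commute[of _ "fps_const d"])
  qed
  have "(\<Prod>p\<in>S. fps_lin (a p)) = D + (\<Sum>p\<in>S. fps_const (c p) * (\<Prod>r\<in>S - {p}. fps_lin (b r)))"
    using arg_cong[OF partial_fraction_poly[OF S inj nz prod_eq], of fps_of_poly]
    by (simp add: fps_of_poly_add fps_of_poly_sum fps_of_poly_prod fps_of_poly_smult fps_lin c_def D_def)
  also have "(\<Sum>p\<in>S. fps_const (c p) * (\<Prod>r\<in>S - {p}. fps_lin (b r))) =
      (\<Sum>p\<in>S. fps_const (c p) * (geo (b p) * D))"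
  proof (rule sum.cong[OF refl])
    fix p assume p: "p \<in> S"
    have "geo (b p) * D = geo (b p) * fps_lin (b p) * (\<Prod>r\<in>S - {p}. fps_lin (b r))"
      unfolding D_def prod.remove[OF S p] by (simp only: mult.assoc)
    then show "fps_const (c p) * (\<Prod>r\<in>S - {p}. fps_lin (b r)) = fps_const (c p) * (geo (b p) * D)"
      by (simp add: geo)
  qed
  also have "D + \<dots> = (1 + (\<Sum>p\<in>S. fps_const (c p) * geo (b p))) * D"
    by (simp add: distrib_right sum_distrib_right mult.assoc)
  finally have "F * D = (1 + (\<Sum>p\<in>S. fps_const (c p) * geo (b p))) * D"
    using F by (simp add: D_def)
  moreover have "D \<noteq> 0"
    using S by (simp add: D_def)
  ultimately have "F = 1 + (\<Sum>p\<in>S. fps_const (c p) * geo (b p))"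
    by simp
  then show ?thesis
    by (simp add: fps_sum_nth geo_def c_def)
qed

text \<open>
  The coefficients of \<open>1 / (1 - u\<^sub>i z)\<close> and of \<open>1 / (1 - u\<^sub>i z / q)\<close> in the partial fraction decomposition
  of the series \<open>psi_series I q t u\<close>.
\<close>

definition psi_residue :: "'i set \<Rightarrow> 'a::field \<Rightarrow> 'a \<Rightarrow> ('i \<Rightarrow> 'a) \<Rightarrow> 'i \<Rightarrow> 'a" where
  "psi_residue I q t u i = (1 - t / q) * (1 - 1 / t) / (1 - 1 / q) *
    (\<Prod>j\<in>I - {i}. (1 - t / q * (u j / u i)) * (1 - u j / u i / t) /
      ((1 - u j / u i) * (1 - u j / u i / q)))"

definition psi_residue' :: "'i set \<Rightarrow> 'a::field \<Rightarrow> 'a \<Rightarrow> ('i \<Rightarrow> 'a) \<Rightarrow> 'i \<Rightarrow> 'a" where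
  "psi_residue' I q t u i = (1 - t) * (1 - q / t) / (1 - q) *
    (\<Prod>j\<in>I - {i}. (1 - t * (u j / u i)) * (1 - q / t * (u j / u i)) /
      ((1 - q * (u j / u i)) * (1 - u j / u i)))"

lemma prod_pair_bool: "(\<Prod>p\<in>I \<times> (UNIV::bool set). f p) = (\<Prod>i\<in>I. f (i, True) * f (i, False))"
  for f :: "'i \<times> bool \<Rightarrow> 'a::comm_monoid_mult"
  using prod.cartesian_product[of "\<lambda>i c. f (i, c)" UNIV I] by (simp add: UNIV_bool mult.commute)

lemma sum_pair_bool: "(\<Sum>p\<in>I \<times> (UNIV::bool set). f p) = (\<Sum>i\<in>I. f (i, True) + f (i, False))"
  for f :: "'i \<times> bool \<Rightarrow> 'a::comm_monoid_add"
  using sum.cartesian_product[of "\<lambda>i c. f (i, c)" UNIV I] by (simp add: UNIV_bool add.commute)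

lemma prod_pair_bool_remove:
  fixes f :: "'i \<times> bool \<Rightarrow> 'a::comm_monoid_mult"
  assumes "finite I" "i \<in> I"
  shows "(\<Prod>p\<in>I \<times> (UNIV::bool set) - {(i, c)}. f p) =
    f (i, \<not> c) * (\<Prod>j\<in>I - {i}. f (j, True) * f (j, False))"
proof -
  have "I \<times> (UNIV::bool set) - {(i, c)} = insert (i, \<not> c) ((I - {i}) \<times> UNIV)"
    using assms(2) by auto
  then show ?thesis
    using assms(1) by (simp add: prod_pair_bool)
qed

lemma psi_series_nth:
  fixes u :: "'i \<Rightarrow> 'a::field"
  assumes I: "finite I" and q: "q \<noteq> 0" "q \<noteq> 1" and t: "t \<noteq> 0"
    and u: "\<And>i. u i \<noteq> 0" "\<And>i j. i \<noteq> j \<Longrightarrow> u i \<noteq> u j" "\<And>i j. i \<noteq> j \<Longrightarrow> u j \<noteq> q * u i"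
  shows "fps_nth (psi_series I q t u) n = (if n = 0 then 1 else 0) +
    (\<Sum>i\<in>I. psi_residue I q t u i * u i ^ n + psi_residue' I q t u i * (u i / q) ^ n)"
proof -
  \<comment> \<open>Poles are indexed by pairs: \<open>True\<close> for the denominator factor of
    \<open>u i\<close>, \<open>False\<close> for that of \<open>u i / q\<close>. The numerator
    entries \<open>t / q * u i\<close> and \<open>u i / t\<close> have the same product as these
    two.\<close>
  define a where "a = (\<lambda>(i, c). if c then t / q * u i else u i / t)"
  define b where "b = (\<lambda>(i, c). if c then u i else u i / q)"
  let ?S = "I \<times> (UNIV::bool set)"
  have neq: "u j \<noteq> q * u i" "q * u i \<noteq> u j"     "u i = u j \<longleftrightarrow> i = j" for i j
    using u(2)[of i j] u(3)[of i j] u(1)[of i] q(2) by (cases "i = j"; force)+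
  have "inj_on b ?S"
  proof (rule inj_onI)
    fix p p' assume "b p = b p'"
    with neq show "p = p'"
      using q by (cases p; cases p') (auto simp: b_def field_simps split: if_splits)
  qed
  moreover have "b p \<noteq> 0" for p
    using u q by (cases p) (simp add: b_def)
  moreover have "(\<Prod>p\<in>?S. a p) = (\<Prod>p\<in>?S. b p)"
    unfolding prod_pair_bool using t by (simp add: a_def b_def)
  moreover have "psi_series I q t u * (\<Prod>p\<in>?S. fps_lin (b p)) = (\<Prod>p\<in>?S. fps_lin (a p))"
    unfolding prod_pair_bool psi_series_def prod.distrib[symmetric]
    by (intro prod.cong refl) (simp add: a_def b_def fps_divide_mult_cancel)
  ultimately have *: "fps_nth (psi_series I q t u) n = (if n = 0 then 1 else 0) +
    (\<Sum>p\<in>?S. (\<Prod>r\<in>?S. 1 - a r / b p) / (\<Prod>r\<in>?S - {p}. 1 - b r / b p) * b p ^ n)"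
    by (intro partial_fraction_fps) (use I in auto)
  show ?thesis
    unfolding * sum_pair_bool
  proof (intro arg_cong2[where f = "(+)"] sum.cong refl)
    fix i assume i: "i \<in> I"
    have ab: "a (j, True) / b (i, True) = t / q * (u j / u i)" "a (j, False) / b (i, True) = u j / u i / t"
      "b (j, True) / b (i, True) = u j / u i" "b (j, False) / b (i, True) = u j / u i / q"
      "a (j, True) / b (i, False) = t * (u j / u i)" "a (j, False) / b (i, False) = q / t * (u j / u i)"
      "b (j, True) / b (i, False) = q * (u j / u i)" "b (j, False) / b (i, False) = u j / u i" for j
      using q(1) by (simp_all add: a_def b_def)
    have own: "u i / u i = 1" "(\<not> True) = False" "(\<not> False) = True"
      using u(1) by simp_all
    have "(\<Prod>r\<in>?S. 1 - a r / b (i, True)) / (\<Prod>r\<in>?S - {(i, True)}. 1 - b r / b (i, True)) =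
      psi_residue I q t u i"
      unfolding prod_pair_bool prod_pair_bool_remove[OF I i] psi_residue_def prod.remove[OF I i]
        ab own prod_dividef times_divide_times_eq using u(1)[of i] by simp
    then show "(\<Prod>r\<in>?S. 1 - a r / b (i, True)) / (\<Prod>r\<in>?S - {(i, True)}. 1 - b r / b (i, True)) *
        b (i, True) ^ n = psi_residue I q t u i * u i ^ n"
      by (simp add: b_def)
    have "(\<Prod>r\<in>?S. 1 - a r / b (i, False)) / (\<Prod>r\<in>?S - {(i, False)}. 1 - b r / b (i, False)) =
      psi_residue' I q t u i"
      unfolding prod_pair_bool prod_pair_bool_remove[OF I i] psi_residue'_def prod.remove[OF I i]
        ab own prod_dividef times_divide_times_eq using u(1)[of i] by simp
    then show "(\<Prod>r\<in>?S. 1 - a r / b (i, False)) / (\<Prod>r\<in>?S - {(i, False)}. 1 - b r / b (i, False)) *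
        b (i, False) ^ n = psi_residue' I q t u i * (u i / q) ^ n"
      by (simp add: b_def)
  qed
qed

text \<open>Replacing \<open>u i\<close> by \<open>q / u i\<close> sends each of the families
  \<open>u i\<close> and \<open>u i / q\<close> to the inverses of the other, hence exchanges the
  two kinds of residues. The factors with \<open>j\<close> in \<open>I - {i}\<close> match; the
  constant in front has one more factor above than below and changes sign.\<close>

lemma psi_residue_inverse:
  fixes u :: "'i \<Rightarrow> 'a::field"
  assumes q: "q \<noteq> 0" and t: "t \<noteq> 0" and u: "\<And>i. u i \<noteq> 0"
  shows "psi_residue I q t (\<lambda>i. q / u i) i = - psi_residue' I q t u i"
    and "psi_residue' I q t (\<lambda>i. q / u i) i = - psi_residue I q t u i"
proof -
  have v: "q / u j / (q / u i) = u i / u j" for j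
    using q by simp
  \<comment> \<open>Each \<open>1 - a\<close> equals \<open>- a * (1 - 1 / a)\<close>, and the
    prefactors cancel because \<open>a * b = c * d\<close>.\<close>
  have flip: "(1 - a) * (1 - b) / ((1 - c) * (1 - d)) = (1 - 1 / a) * (1 - 1 / b) / ((1 - 1 / c) * (1 - 1 / d))"
    if "a \<noteq> 0" "b \<noteq> 0" "c \<noteq> 0" "d \<noteq> 0" "a * b = c * d" for a b c d :: 'a
  proof -
    have "(1 - 1 / a) * (1 - 1 / b) = (1 - a) * (1 - b) / (a * b)"
      "(1 - 1 / c) * (1 - 1 / d) = (1 - c) * (1 - d) / (c * d)"
      using that(1-4) by (simp_all add: divide_simps, simp_all add: algebra_simps)
    then show ?thesis
      using that by simp
  qed
  have "(1 - t / q * (u i / u j)) * (1 - u i / u j / t) / ((1 - u i / u j) * (1 - u i / u j / q)) =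
    (1 - t * (u j / u i)) * (1 - q / t * (u j / u i)) / ((1 - q * (u j / u i)) * (1 - u j / u i))" for j
    by (subst flip) (use q t u in \<open>simp_all add: mult.commute\<close>)
  moreover have "(1 - t / q) * (1 - 1 / t) / (1 - 1 / q) = - ((1 - t) * (1 - q / t) / (1 - q))"
    using q t by (cases "q = 1") (simp_all add: divide_simps, simp_all add: algebra_simps)
  ultimately show "psi_residue I q t (\<lambda>i. q / u i) i = - psi_residue' I q t u i"
    unfolding psi_residue_def psi_residue'_def v by (simp only: mult_minus_left)
  have "(1 - t * (u i / u j)) * (1 - q / t * (u i / u j)) / ((1 - q * (u i / u j)) * (1 - u i / u j)) =
    (1 - t / q * (u j / u i)) * (1 - u j / u i / t) / ((1 - u j / u i) * (1 - u j / u i / q))" for j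
    by (subst flip) (use q t u in \<open>simp_all add: mult.commute\<close>)
  moreover have "(1 - t) * (1 - q / t) / (1 - q) = - ((1 - t / q) * (1 - 1 / t) / (1 - 1 / q))"
    using q t by (cases "q = 1") (simp_all add: divide_simps, simp_all add: algebra_simps)
  ultimately show "psi_residue' I q t (\<lambda>i. q / u i) i = - psi_residue I q t u i"
    unfolding psi_residue_def psi_residue'_def v by (simp only: mult_minus_left)
qed

lemma psi_series_nth_0: "fps_nth (psi_series I q t u) 0 = 1"
  by (induction I rule: infinite_finite_induct) (simp_all add: psi_series_def fps_divide_unit)

text \<open>The term \<open>c / (1 - b * z)\<close> has coefficients \<open>c * b^n\<close> for
  \<open>n >= 0\<close> when expanded in z, and \<open>- c * b^n\<close> for \<open>n < 0\<close>
  when expanded in 1/z. The difference of the two expansions thus has the coefficient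
  \<open>c * b^n\<close> at every integer.\<close>

lemma psi_series_difference:
  fixes u :: "'i \<Rightarrow> 'a::field"
  assumes I: "finite I" and q: "q \<noteq> 0" "q \<noteq> 1" and t: "t \<noteq> 0"
    and u: "\<And>i. u i \<noteq> 0" "\<And>i j. i \<noteq> j \<Longrightarrow> u i \<noteq> u j" "\<And>i j. i \<noteq> j \<Longrightarrow> u j \<noteq> q * u i"
  shows "fps_coeff_int (psi_series I q t u) n -
      fps_coeff_int (psi_series I q t (\<lambda>i. q / u i)) (- n) =
    (\<Sum>i\<in>I. psi_residue I q t u i * u i powi n + psi_residue' I q t u i * (u i / q) powi n)"
proof -
  define c c' where "c = psi_residue I q t u" and "c' = psi_residue' I q t u"
  have plus: "fps_nth (psi_series I q t u) k = (if k = 0 then 1 else 0) +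
    (\<Sum>i\<in>I. c i * u i ^ k + c' i * (u i / q) ^ k)" for k
    unfolding c_def c'_def by (rule psi_series_nth) fact+
  have "fps_nth (psi_series I q t (\<lambda>i. q / u i)) k = (if k = 0 then 1 else 0) +
    (\<Sum>i\<in>I. psi_residue I q t (\<lambda>i. q / u i) i * (q / u i) ^ k +
      psi_residue' I q t (\<lambda>i. q / u i) i * (q / u i / q) ^ k)" for k
    using u q by (intro psi_series_nth I t) (auto simp: field_simps)
  note minus_raw = this
  have inverses: "q / u i / q = inverse (u i)" "q / u i = inverse (u i / q)" for i
    using q(1) by (simp_all add: divide_inverse)
  from minus_raw have minus: "fps_nth (psi_series I q t (\<lambda>i. q / u i)) k = (if k = 0 then 1 else 0) -
    (\<Sum>i\<in>I. c i * inverse (u i) ^ k + c' i * inverse (u i / q) ^ k)" for k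
    unfolding psi_residue_inverse[of q t u, OF q(1) t u(1)] unfolding c_def c'_def inverses
    by (simp add: sum.distrib sum_negf sum_subtractf q(1) inverse_eq_divide)
  consider "n = 0" | "n > 0" | "n < 0" by linarith
  then show ?thesis
    unfolding c_def[symmetric] c'_def[symmetric]
  proof cases
    \<comment> \<open>Both constant terms are 1, and the expansion \<open>plus\<close> in degree 0
      says that the residues sum to 0.\<close>
    case 1
    then show "fps_coeff_int (psi_series I q t u) n - fps_coeff_int (psi_series I q t (\<lambda>i. q / u i)) (- n) =
      (\<Sum>i\<in>I. c i * u i powi n + c' i * (u i / q) powi n)"
      using plus[of 0] psi_series_nth_0[of I q t] by (simp add: fps_coeff_int_def)
  next
    case 2
    then show "fps_coeff_int (psi_series I q t u) n - fps_coeff_int (psi_series I q t (\<lambda>i. q / u i)) (- n) =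
      (\<Sum>i\<in>I. c i * u i powi n + c' i * (u i / q) powi n)"
      by (simp add: fps_coeff_int_def plus power_int_def)
  next
    case 3
    then show "fps_coeff_int (psi_series I q t u) n - fps_coeff_int (psi_series I q t (\<lambda>i. q / u i)) (- n) =
      (\<Sum>i\<in>I. c i * u i powi n + c' i * (u i / q) powi n)"
      by (simp add: fps_coeff_int_def minus power_int_def)
  qed
qed

text \<open>The i-th summand is \<open>rec\<close> at index \<open>m\<close>, times the weight and
  \<open>y i powi (n - 3)\<close>; no cancellation between different shifts is involved.\<close>

lemma (in shift_system) psi_relation:
  fixes p :: "int \<Rightarrow> 'a"
  assumes rec: "\<And>i n. i \<in> I \<Longrightarrow>
    G i (p n) - \<sigma>\<^sub>1 * y i * G i (p (n - 1)) + \<sigma>\<^sub>2 * (y i)^2 * G i (p (n - 2)) - (y i)^3 * G i (p (n - 3)) =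
    p n - \<sigma>\<^sub>2 * y i * p (n - 1) + \<sigma>\<^sub>1 * (y i)^2 * p (n - 2) - (y i)^3 * p (n - 3)"
  shows "p (m - 3) * E n f - \<sigma>\<^sub>1 * (p (m - 2) * E (n - 1) f) + \<sigma>\<^sub>2 * (p (m - 1) * E (n - 2) f) -
      p m * E (n - 3) f +
    (E (n - 3) (p m * f) - \<sigma>\<^sub>1 * E (n - 2) (p (m - 1) * f) + \<sigma>\<^sub>2 * E (n - 1) (p (m - 2) * f) -
      E n (p (m - 3) * f)) = 0"
proof -
  have powi: "u powi (n - 2) = u powi (n - 3) * u" "u powi (n - 1) = u powi (n - 3) * u^2"
    "u powi n = u powi (n - 3) * u^3" if "u \<noteq> 0" for u :: 'a
    using that power_int_add[of u "n - 3" 1] power_int_add[of u "n - 3" 2] power_int_add[of u "n - 3" 3]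
    by (auto simp: algebra_simps)
  have "(\<Sum>i\<in>I. A i * G i f * y i powi (n - 3) *
    ((G i (p m) - \<sigma>\<^sub>1 * y i * G i (p (m - 1)) + \<sigma>\<^sub>2 * (y i)^2 * G i (p (m - 2)) - (y i)^3 * G i (p (m - 3))) -
     (p m - \<sigma>\<^sub>2 * y i * p (m - 1) + \<sigma>\<^sub>1 * (y i)^2 * p (m - 2) - (y i)^3 * p (m - 3)))) = 0"
    by (intro sum.neutral ballI) (simp add: rec)
  moreover have "p (m - 3) * E n f - \<sigma>\<^sub>1 * (p (m - 2) * E (n - 1) f) + \<sigma>\<^sub>2 * (p (m - 1) * E (n - 2) f) -
      p m * E (n - 3) f +
    (E (n - 3) (p m * f) - \<sigma>\<^sub>1 * E (n - 2) (p (m - 1) * f) + \<sigma>\<^sub>2 * E (n - 1) (p (m - 2) * f) -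
      E n (p (m - 3) * f)) = C * (\<Sum>i\<in>I. A i * G i f * y i powi (n - 3) *
    ((G i (p m) - \<sigma>\<^sub>1 * y i * G i (p (m - 1)) + \<sigma>\<^sub>2 * (y i)^2 * G i (p (m - 2)) - (y i)^3 * G i (p (m - 3))) -
     (p m - \<sigma>\<^sub>2 * y i * p (m - 1) + \<sigma>\<^sub>1 * (y i)^2 * p (m - 2) - (y i)^3 * p (m - 3))))"
    unfolding mac_current_def G_hom(2) powi[OF y_nonzero]
    by (simp add: sum_distrib_left sum.distrib sum_subtractf algebra_simps)
  ultimately show ?thesis
    by simp
qed

section \<open>The commutator of the two currents\<close>

text \<open>\<open>y i / q\<close> stands for q^(-1/2) x_i, the variable of f. Both constants must
  be fixed by both families of shifts to be pulled out of the mixed products.\<close>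

locale shift_pair =
  shift_system I y q s C G + inv: shift_system I "\<lambda>i. y i / q" "1 / q" "1 / s" C' H
  for I :: "'i set" and y :: "'i \<Rightarrow> 'a::field" and q s C G C' H +
  assumes G_H: "G i (H i f) = f" and H_G: "H i (G i f) = f"
    and G_H_commute: "G i (H j f) = H j (G i f)"
    and G_C': "G i C' = C'" and H_C: "H i C = C"
    and q_neq_1: "q \<noteq> 1"
begin

lemma mac_coeff_inv: "mac_coeff I (\<lambda>i. y i / q) (1 / s) = mac_coeff I y (1 / s)"
proof
  fix i
  have "mac_ratio (1 / s) (y i / q) (y j / q) = mac_ratio (1 / s) (y i) (y j)" for j
    using mac_ratio_scale[of "1 / q" "1 / s" "y i" "y j"] q_nonzero by simp
  then show "mac_coeff I (\<lambda>i. y i / q) (1 / s) i = mac_coeff I y (1 / s) i"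
    by (simp add: mac_coeff_def mac_prod_def)
qed

abbreviation "F \<equiv> mac_current I (\<lambda>i. y i / q) (1 / s) C' H"
abbreviation "A' \<equiv> mac_coeff I y (1 / s)"

lemma H_q: "H i q = q" and H_s: "H i s = s"
  using inv.G_q[of i] inv.G_s[of i] by (simp_all add: inv.G_hom)

lemma H_y: "H i (y j) = (if i = j then y j / q else y j)"
proof -
  have "H i (y j) = H i (y j / q) * q"
    using q_nonzero by (simp add: inv.G_hom H_q)
  then show ?thesis
    using q_nonzero inv.G_y[of i j] by auto
qed

text \<open>Since \<open>mac_ratio (1 / s) v u = mac_ratio s u v\<close>, both sides equal
  \<open>mac_ratio s (y i) (y j) * mac_ratio s (q * y i) (y j)\<close>.\<close>

lemma mac_ratio_exchange:
  assumes "i \<noteq> j"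
  shows "mac_ratio s (y i) (y j) * mac_ratio (1 / s) (y j) (q * y i) =
    mac_ratio (1 / s) (y j) (y i) * mac_ratio s (y i) (y j / q)"
proof -
  have "mac_ratio s (y i) (y j / q) = mac_ratio s (q * y i) (y j)"
    using mac_ratio_scale[of q s "y i" "y j / q"] q_nonzero by simp
  moreover have "mac_ratio (1 / s) v u = mac_ratio s u v" for u v
    by (cases "u = v") (simp_all add: mac_ratio_def divide_simps, simp add: algebra_simps)
  ultimately show ?thesis
    by simp
qed

lemma E_F:
  "E m (F n f) = C * C' * (\<Sum>i\<in>I. \<Sum>j\<in>I.
    A i * G i (A' j) * (y i powi m * (G i (y j) / q) powi n) * G i (H j f))"
  unfolding mac_current_def mac_coeff_inv G_hom G_C' G_q
  by (simp add: sum_distrib_left mult_ac)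

lemma F_E:
  "F n (E m f) = C * C' * (\<Sum>i\<in>I. \<Sum>j\<in>I.
    A' j * H j (A i) * (H j (y i) powi m * (y j / q) powi n) * G i (H j f))"
proof -
  have "F n (E m f) = C * C' * (\<Sum>j\<in>I. \<Sum>i\<in>I.
    A' j * H j (A i) * (H j (y i) powi m * (y j / q) powi n) * G i (H j f))"
    unfolding mac_current_def mac_coeff_inv inv.G_hom H_C
    by (simp add: sum_distrib_left mult_ac G_H_commute)
  then show ?thesis
    by (subst sum.swap)
qed

text \<open>Each of the two shifts affects the other weight only through the ratio of
  \<open>y i\<close> and \<open>y j\<close>, where \<open>mac_ratio_exchange\<close> applies. This
  removes the off-diagonal terms of the commutator.\<close>

lemma weights_exchange:
  assumes "i \<in> I" "j \<in> I" "i \<noteq> j"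
  shows "A i * G i (A' j) = A' j * H j (A i)"
proof -
  have ratio: "G i (mac_ratio (1 / s) u v) = mac_ratio (1 / s) (G i u) (G i v)"
    "H i (mac_ratio s u v) = mac_ratio s (H i u) (H i v)" for i u v
    by (simp_all add: mac_ratio_def G_hom inv.G_hom G_s H_s)
  have Ai: "A i = mac_ratio s (y i) (y j) * mac_prod I y s {i, j} (y i)"
    by (rule A_split) fact+
  have A'j: "A' j = mac_ratio (1 / s) (y j) (y i) * mac_prod I y (1 / s) {i, j} (y j)"
    unfolding mac_coeff_def using assms finite_I
    by (subst mac_prod_remove[of _ i]) auto
  have "G i (mac_prod I y (1 / s) {i, j} (y j)) = mac_prod I y (1 / s) {i, j} (y j)"
    unfolding mac_prod_def G_hom
    by (intro prod.cong refl) (use assms in \<open>auto simp: ratio G_y\<close>)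
  moreover have "H j (mac_prod I y s {i, j} (y i)) = mac_prod I y s {i, j} (y i)"
    unfolding mac_prod_def inv.G_hom
    by (intro prod.cong refl) (use assms in \<open>auto simp: ratio H_y\<close>)
  ultimately have "G i (A' j) = mac_ratio (1 / s) (y j) (q * y i) * mac_prod I y (1 / s) {i, j} (y j)"
    "H j (A i) = mac_ratio s (y i) (y j / q) * mac_prod I y s {i, j} (y i)"
    unfolding Ai A'j using assms by (simp_all add: G_hom(2) inv.G_hom(2) ratio G_y H_y)
  then have "A i * G i (A' j) =
    (mac_ratio s (y i) (y j) * mac_ratio (1 / s) (y j) (q * y i)) *
    (mac_prod I y s {i, j} (y i) * mac_prod I y (1 / s) {i, j} (y j))"
    "A' j * H j (A i) = (mac_ratio (1 / s) (y j) (y i) * mac_ratio s (y i) (y j / q)) *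
    (mac_prod I y s {i, j} (y i) * mac_prod I y (1 / s) {i, j} (y j))"
    unfolding Ai A'j by (simp_all only: mult_ac)
  then show ?thesis
    using mac_ratio_exchange[OF assms(3)] by simp
qed

lemma commutator_sum:
  "E m (F n f) - F n (E m f) = C * C' * (\<Sum>i\<in>I.
    A i * G i (A' i) * y i powi (m + n) - A' i * H i (A i) * (y i / q) powi (m + n)) * f"
proof -
  \<comment> \<open>On the diagonal \<open>G i (y i) / q = y i\<close> and
    \<open>H i (y i) = y i / q\<close>, so in each product the two powers have a common base and
    depend on \<open>m + n\<close> only: this is the delta function.\<close>
  have "A i * G i (A' j) * (y i powi m * (G i (y j) / q) powi n) * G i (H j f) -
      A' j * H j (A i) * (H j (y i) powi m * (y j / q) powi n) * G i (H j f) =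
    (if i = j then (A i * G i (A' i) * y i powi (m + n) - A' i * H i (A i) * (y i / q) powi (m + n)) * f
     else 0)" if "i \<in> I" "j \<in> I" for i j
    using q_nonzero y_nonzero[of i] weights_exchange[OF that]
    by (auto simp: G_y H_y G_H power_int_add algebra_simps)
  then have "E m (F n f) - F n (E m f) = C * C' * (\<Sum>i\<in>I. \<Sum>j\<in>I.
    if i = j then (A i * G i (A' i) * y i powi (m + n) - A' i * H i (A i) * (y i / q) powi (m + n)) * f
    else 0)"
    unfolding E_F F_E right_diff_distrib[symmetric] sum_subtractf[symmetric]
    by (intro arg_cong2[where f = "(*)"] refl sum.cong)
  then show ?thesis
    by (simp add: finite_I sum_distrib_right mult.assoc)
qed

text \<open>With t = \<open>s^2\<close> these are the products in \<open>psi_residue\<close> and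
  \<open>psi_residue'\<close>; the constants in front of them are supplied by \<open>C * C'\<close>
  and g(1,1).\<close>

lemma diagonal_weights:
  "A i * G i (A' i) = (\<Prod>j\<in>I - {i}. (1 - s^2 / q * (y j / y i)) * (1 - y j / y i / s^2) /
      ((1 - y j / y i) * (1 - y j / y i / q)))"
  "A' i * H i (A i) = (\<Prod>j\<in>I - {i}. (1 - s^2 * (y j / y i)) * (1 - q / s^2 * (y j / y i)) /
      ((1 - q * (y j / y i)) * (1 - y j / y i)))"
proof -
  have ratio: "mac_ratio s u w = (s - w / u / s) / (1 - w / u)" if "u \<noteq> 0" for s u w :: 'a
    using that by (simp add: mac_ratio_def diff_divide_distrib[symmetric] divide_simps)
  have "A i * G i (A' i) = (\<Prod>j\<in>I - {i}. mac_ratio s (y i) (y j) * mac_ratio (1 / s) (q * y i) (y j))"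
    unfolding mac_coeff_def mac_prod_def G_hom prod.distrib
    by (intro arg_cong2[where f = "(*)"] prod.cong) (auto simp: mac_ratio_def G_hom G_s G_y)
  also have "\<dots> = (\<Prod>j\<in>I - {i}. (1 - s^2 / q * (y j / y i)) * (1 - y j / y i / s^2) /
      ((1 - y j / y i) * (1 - y j / y i / q)))"
  proof (rule prod.cong[OF refl])
    fix j
    define v where "v = y j / y i"
    have v': "y j / (q * y i) = v / q"
      by (simp add: v_def)
    have "mac_ratio s (y i) (y j) * mac_ratio (1 / s) (q * y i) (y j) =
      (s - v / s) * (1 / s - v / q * s) / ((1 - v) * (1 - v / q))"
      using y_nonzero[of i] q_nonzero by (simp add: ratio v' v_def)
    also have "(s - v / s) * (1 / s - v / q * s) = (1 - s^2 / q * v) * (1 - v / s^2)"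
      using s_nonzero q_nonzero by (simp add: field_simps power2_eq_square)
    finally show "mac_ratio s (y i) (y j) * mac_ratio (1 / s) (q * y i) (y j) =
      (1 - s^2 / q * (y j / y i)) * (1 - y j / y i / s^2) /
      ((1 - y j / y i) * (1 - y j / y i / q))"
      by (simp add: v_def)
  qed
  finally show "A i * G i (A' i) = \<dots>" .
  have "A' i * H i (A i) = (\<Prod>j\<in>I - {i}. mac_ratio (1 / s) (y i) (y j) * mac_ratio s (y i / q) (y j))"
    unfolding mac_coeff_def mac_prod_def inv.G_hom prod.distrib
    by (intro arg_cong2[where f = "(*)"] prod.cong) (auto simp: mac_ratio_def inv.G_hom H_s H_y)
  also have "\<dots> = (\<Prod>j\<in>I - {i}. (1 - s^2 * (y j / y i)) * (1 - q / s^2 * (y j / y i)) /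
      ((1 - q * (y j / y i)) * (1 - y j / y i)))"
  proof (rule prod.cong[OF refl])
    fix j
    define v where "v = y j / y i"
    have v': "y j / (y i / q) = q * v"
      by (simp add: v_def)
    have "mac_ratio (1 / s) (y i) (y j) * mac_ratio s (y i / q) (y j) =
      (1 / s - v * s) * (s - q * v / s) / ((1 - q * v) * (1 - v))"
      using y_nonzero[of i] q_nonzero by (simp add: ratio v' v_def mult.commute)
    also have "(1 / s - v * s) * (s - q * v / s) = (1 - s^2 * v) * (1 - q / s^2 * v)"
      using s_nonzero by (simp add: field_simps power2_eq_square)
    finally show "mac_ratio (1 / s) (y i) (y j) * mac_ratio s (y i / q) (y j) =
      (1 - s^2 * (y j / y i)) * (1 - q / s^2 * (y j / y i)) /
      ((1 - q * (y j / y i)) * (1 - y j / y i))"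
      by (simp add: v_def)
  qed
  finally show "A' i * H i (A i) = \<dots>" .
qed

lemma commutator_relation:
  assumes C: "C * C' = 1 / ((1 - q) * (1 - 1 / q))" and t: "s^2 \<noteq> 1" "s^2 \<noteq> q"
  shows "E m (F n f) - F n (E m f) = 1 / ((1 - q) * (1 - 1 / s^2) * (1 - s^2 / q)) *
    (fps_coeff_int (psi_series I q (s^2) y) (m + n) -
     fps_coeff_int (psi_series I q (s^2) (\<lambda>i. q / y i)) (- (m + n))) * f"
proof -
  define g where "g = 1 / ((1 - q) * (1 - 1 / s^2) * (1 - s^2 / q))"
  have nz: "1 - 1 / s^2 \<noteq> 0" "1 - s^2 / q \<noteq> 0" "1 - q \<noteq> 0"
    using t s_nonzero q_nonzero q_neq_1 by (auto simp: field_simps)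
  have "(1 - s^2) * (1 - q / s^2) = q * ((1 - 1 / s^2) * (1 - s^2 / q))"
    using s_nonzero q_nonzero by (simp add: field_simps)
  moreover have "1 - 1 / q = - ((1 - q) / q)"
    using q_nonzero by (simp add: field_simps)
  \<comment> \<open>One constant in two forms, for \<open>psi_residue\<close> and for
    \<open>psi_residue'\<close>, with \<open>g\<close> equal to 1 / g(1,1); the sign in the second
    absorbs the minus sign of the commutator.\<close>
  ultimately have c: "C * C' = g * ((1 - s^2 / q) * (1 - 1 / s^2) / (1 - 1 / q))"
    "C * C' = - (g * ((1 - s^2) * (1 - q / s^2) / (1 - q)))"
    using nz q_nonzero by (simp_all add: C g_def)
  have "C * C' * (A i * G i (A' i) * y i powi (m + n) - A' i * H i (A i) * (y i / q) powi (m + n)) =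
    g * (psi_residue I q (s^2) y i * y i powi (m + n) + psi_residue' I q (s^2) y i * (y i / q) powi (m + n))" for i
    unfolding right_diff_distrib mult.assoc[symmetric]
    unfolding psi_residue_def psi_residue'_def diagonal_weights[symmetric]
    by (subst c(2), subst c(1)) (simp add: algebra_simps)
  then have "C * C' * (\<Sum>i\<in>I.
      A i * G i (A' i) * y i powi (m + n) - A' i * H i (A i) * (y i / q) powi (m + n)) =
    g * (\<Sum>i\<in>I. psi_residue I q (s^2) y i * y i powi (m + n) + psi_residue' I q (s^2) y i * (y i / q) powi (m + n))"
    by (simp add: sum_distrib_left)
  also have "(\<Sum>i\<in>I. psi_residue I q (s^2) y i * y i powi (m + n) + psi_residue' I q (s^2) y i * (y i / q) powi (m + n)) =
    fps_coeff_int (psi_series I q (s^2) y) (m + n) -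
     fps_coeff_int (psi_series I q (s^2) (\<lambda>i. q / y i)) (- (m + n))"
    using y_neq y_neq_q by (intro psi_series_difference[symmetric] finite_I q_nonzero q_neq_1 y_nonzero) 
      (auto simp: s_nonzero)
  finally show ?thesis
    unfolding commutator_sum g_def by simp
qed

end

section \<open>Substitutions in rational functions\<close>

lemma poly_mapping_sum_single: "(\<Sum>m\<in>Poly_Mapping.keys p. Poly_Mapping.single m (Poly_Mapping.lookup p m)) = p"
  by (rule poly_mapping_eqI) (auto simp: lookup_sum lookup_single when_def in_keys_iff)

definition mon_eval :: "(nat \<Rightarrow> 'b::comm_ring_1) \<Rightarrow> (nat \<Rightarrow>\<^sub>0 nat) \<Rightarrow> 'b" where
  "mon_eval \<sigma> m = (\<Prod>i\<in>Poly_Mapping.keys m. \<sigma> i ^ Poly_Mapping.lookup m i)"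

lemma mon_eval_superset:
  "finite S \<Longrightarrow> Poly_Mapping.keys m \<subseteq> S \<Longrightarrow> mon_eval \<sigma> m = (\<Prod>i\<in>S. \<sigma> i ^ Poly_Mapping.lookup m i)"
  unfolding mon_eval_def by (intro prod.mono_neutral_left) (auto simp: in_keys_iff)

lemma mon_eval_0 [simp]: "mon_eval \<sigma> 0 = 1"
  by (simp add: mon_eval_def)

lemma mon_eval_single [simp]: "mon_eval \<sigma> (Poly_Mapping.single i n) = \<sigma> i ^ n"
  by (simp add: mon_eval_def)

lemma mon_eval_add: "mon_eval \<sigma> (m + m') = mon_eval \<sigma> m * mon_eval \<sigma> m'"
proof -
  let ?S = "Poly_Mapping.keys m \<union> Poly_Mapping.keys m'"
  have "mon_eval \<sigma> (m + m') = (\<Prod>i\<in>?S. \<sigma> i ^ Poly_Mapping.lookup (m + m') i)"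
    by (rule mon_eval_superset) (use keys_add[of m m'] in auto)
  also have "\<dots> = (\<Prod>i\<in>?S. \<sigma> i ^ Poly_Mapping.lookup m i) * (\<Prod>i\<in>?S. \<sigma> i ^ Poly_Mapping.lookup m' i)"
    by (simp add: lookup_add power_add prod.distrib)
  also have "\<dots> = mon_eval \<sigma> m * mon_eval \<sigma> m'"
    by (simp add: mon_eval_superset[of ?S])
  finally show ?thesis .
qed

text \<open>The coefficient map is a parameter: with \<open>cst\<close> this is
  \<open>psubst\<close>, with \<open>pconst\<close> it substitutes polynomials into polynomials,
  where monomial substitutions can be inverted.\<close>

definition poly_eval :: "('c::comm_ring_1 \<Rightarrow> 'b::comm_ring_1) \<Rightarrow> (nat \<Rightarrow> 'b) \<Rightarrow>
    ((nat \<Rightarrow>\<^sub>0 nat) \<Rightarrow>\<^sub>0 'c) \<Rightarrow> 'b" where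
  "poly_eval \<iota> \<sigma> p = (\<Sum>m\<in>Poly_Mapping.keys p. \<iota> (Poly_Mapping.lookup p m) * mon_eval \<sigma> m)"

locale unital_hom =
  fixes \<iota> :: "'c::comm_ring_1 \<Rightarrow> 'b::comm_ring_1"
  assumes add: "\<iota> (a + b) = \<iota> a + \<iota> b" and mult: "\<iota> (a * b) = \<iota> a * \<iota> b" and one: "\<iota> 1 = 1"
begin

lemma zero: "\<iota> 0 = 0"
  using add[of 0 0] by (metis add_cancel_right_left)

lemma power: "\<iota> (a ^ n) = \<iota> a ^ n"
  by (induction n) (simp_all add: one mult)

lemma sum: "\<iota> (sum f S) = (\<Sum>x\<in>S. \<iota> (f x))"
  by (induction S rule: infinite_finite_induct) (simp_all add: zero add)

lemma prod: "\<iota> (prod f S) = (\<Prod>x\<in>S. \<iota> (f x))"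
  by (induction S rule: infinite_finite_induct) (simp_all add: one mult)

lemma of_nat: "\<iota> (of_nat n) = of_nat n"
  by (induction n) (simp_all add: zero one add)

lemma mon_eval: "\<iota> (mon_eval \<sigma> m) = mon_eval (\<lambda>i. \<iota> (\<sigma> i)) m"
  by (simp add: mon_eval_def prod power)

lemma poly_eval: "\<iota> (poly_eval \<kappa> \<sigma> p) = poly_eval (\<lambda>c. \<iota> (\<kappa> c)) (\<lambda>i. \<iota> (\<sigma> i)) p"
  by (simp add: poly_eval_def sum mult mon_eval)

lemma poly_eval_superset:
  "finite S \<Longrightarrow> Poly_Mapping.keys p \<subseteq> S \<Longrightarrow>
    poly_eval \<iota> \<sigma> p = (\<Sum>m\<in>S. \<iota> (Poly_Mapping.lookup p m) * mon_eval \<sigma> m)"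
  unfolding poly_eval_def by (intro sum.mono_neutral_left) (auto simp: in_keys_iff zero)

lemma poly_eval_add: "poly_eval \<iota> \<sigma> (p + p') = poly_eval \<iota> \<sigma> p + poly_eval \<iota> \<sigma> p'"
proof -
  let ?S = "Poly_Mapping.keys p \<union> Poly_Mapping.keys p'"
  have "poly_eval \<iota> \<sigma> (p + p') = (\<Sum>m\<in>?S. \<iota> (Poly_Mapping.lookup (p + p') m) * mon_eval \<sigma> m)"
    by (rule poly_eval_superset) (use keys_add[of p p'] in auto)
  also have "\<dots> = (\<Sum>m\<in>?S. \<iota> (Poly_Mapping.lookup p m) * mon_eval \<sigma> m) +
      (\<Sum>m\<in>?S. \<iota> (Poly_Mapping.lookup p' m) * mon_eval \<sigma> m)"
    by (simp add: lookup_add add distrib_right sum.distrib)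
  also have "\<dots> = poly_eval \<iota> \<sigma> p + poly_eval \<iota> \<sigma> p'"
    by (simp add: poly_eval_superset[of ?S])
  finally show ?thesis .
qed

lemma poly_eval_single: "poly_eval \<iota> \<sigma> (Poly_Mapping.single m c) = \<iota> c * mon_eval \<sigma> m"
  by (simp add: poly_eval_def zero)

lemma poly_eval_sum: "poly_eval \<iota> \<sigma> (sum f S) = (\<Sum>x\<in>S. poly_eval \<iota> \<sigma> (f x))"
  by (induction S rule: infinite_finite_induct) (simp_all add: poly_eval_add, simp_all add: poly_eval_def)

lemma poly_eval_mult: "poly_eval \<iota> \<sigma> (p * p') = poly_eval \<iota> \<sigma> p * poly_eval \<iota> \<sigma> p'"
proof -
  have "p * p' = (\<Sum>m\<in>Poly_Mapping.keys p. Poly_Mapping.single m (Poly_Mapping.lookup p m)) *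
    (\<Sum>m\<in>Poly_Mapping.keys p'. Poly_Mapping.single m (Poly_Mapping.lookup p' m))"
    by (simp only: poly_mapping_sum_single)
  then show ?thesis
    by (simp add: sum_product mult_single poly_eval_sum poly_eval_single mon_eval_add mult,
        simp add: poly_eval_def sum_product mult_ac)
qed

lemma poly_eval_hom: "unital_hom (poly_eval \<iota> \<sigma>)"
  by unfold_locales
    (simp_all add: poly_eval_add poly_eval_mult poly_eval_single one flip: single_one)

end

abbreviation "pconst \<equiv> (Poly_Mapping.single 0 :: 'c::comm_ring_1 \<Rightarrow> (nat \<Rightarrow>\<^sub>0 nat) \<Rightarrow>\<^sub>0 'c)"
definition pvar :: "nat \<Rightarrow> (nat \<Rightarrow>\<^sub>0 nat) \<Rightarrow>\<^sub>0 'c::comm_ring_1" where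
  "pvar i = Poly_Mapping.single (Poly_Mapping.single i 1) 1"

lemma (in unital_hom) poly_eval_pvar: "poly_eval \<iota> \<sigma> (pvar i) = \<sigma> i"
  by (simp add: pvar_def poly_eval_single one)

lemma (in unital_hom) poly_eval_pconst: "poly_eval \<iota> \<sigma> (pconst c) = \<iota> c"
  by (simp add: poly_eval_single)

lemma single_hom: "unital_hom (Poly_Mapping.single 0 :: 'c::comm_ring_1 \<Rightarrow> 'e::comm_monoid_add \<Rightarrow>\<^sub>0 'c)"
  by unfold_locales (simp_all add: single_add mult_single)

lemma single_1_hom: "Poly_Mapping.single (sum f S) 1 = (\<Prod>i\<in>S. Poly_Mapping.single (f i) (1::'c::comm_ring_1))"
proof (induction S rule: infinite_finite_induct)
  case (insert x S)
  then show ?case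
    using mult_single[of "f x" "1::'c" "sum f S" 1] by simp
qed simp_all

lemma mon_eval_pvar: "mon_eval pvar m = Poly_Mapping.single m (1::'c::comm_ring_1)"
proof -
  have "pvar i ^ n = Poly_Mapping.single (Poly_Mapping.single i n) (1::'c)" for i n
    by (induction n) (simp_all add: pvar_def mult_single flip: single_add)
  then have "mon_eval pvar m = (\<Prod>i\<in>Poly_Mapping.keys m.
      Poly_Mapping.single (Poly_Mapping.single i (Poly_Mapping.lookup m i)) (1::'c))"
    by (simp add: mon_eval_def)
  also have "\<dots> = Poly_Mapping.single m 1"
    unfolding single_1_hom[symmetric] poly_mapping_sum_single ..
  finally show ?thesis .
qed

lemma poly_eval_id: "poly_eval pconst pvar p = p"
  by (simp add: poly_eval_def mon_eval_pvar mult_single poly_mapping_sum_single)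

section \<open>Monomial substitutions as endomorphisms of the field of rational functions\<close>

definition to_ratfun :: "pol \<Rightarrow> ratfun" where "to_ratfun p = Fract p 1"

lemma to_ratfun_hom: "unital_hom to_ratfun"
  by unfold_locales (simp_all add: to_ratfun_def One_fract_def)

lemma cst_eq: "cst c = to_ratfun (pconst c)" and X_eq: "X i = to_ratfun (pvar i)"
  by (simp_all add: cst_def X_def to_ratfun_def pvar_def)

lemma to_ratfun_eq_iff: "to_ratfun p = to_ratfun p' \<longleftrightarrow> p = p'"
  by (simp add: to_ratfun_def eq_fract)

lemma Fract_eq: "b \<noteq> 0 \<Longrightarrow> Fract a b = to_ratfun a / to_ratfun b"
  by (simp add: to_ratfun_def)

lemma cst_hom: "unital_hom cst"
  by unfold_locales
    (simp_all add: cst_eq unital_hom.add[OF to_ratfun_hom] unital_hom.mult[OF to_ratfun_hom]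
      unital_hom.one[OF to_ratfun_hom] unital_hom.add[OF single_hom] unital_hom.mult[OF single_hom])

lemma psubst_eq: "psubst \<sigma> = poly_eval cst \<sigma>"
  by (simp add: fun_eq_iff psubst_def poly_eval_def mon_eval_def)

lemma to_ratfun_poly_eval: "to_ratfun p = poly_eval cst X p"
  using unital_hom.poly_eval[OF to_ratfun_hom, of pconst pvar p]
  unfolding poly_eval_id by (simp add: cst_eq[abs_def] X_eq[abs_def])

lemma cst_inject: "cst a = cst b \<longleftrightarrow> a = b"
  by (metis cst_eq to_ratfun_eq_iff lookup_single_eq)

lemma cst_nonzero: "a \<noteq> 0 \<Longrightarrow> cst a \<noteq> 0"
  by (metis cst_inject unital_hom.zero[OF cst_hom])

lemma cst_X: "cst a * X i = to_ratfun (Poly_Mapping.single (Poly_Mapping.single i 1) a)"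
  unfolding cst_eq X_eq by (simp add: pvar_def mult_single flip: unital_hom.mult[OF to_ratfun_hom])

lemma cst_X_neq:
  assumes "i \<noteq> j" "a \<noteq> 0"
  shows "cst a * X i \<noteq> cst b * X j"
proof
  assume "cst a * X i = cst b * X j"
  then have *: "Poly_Mapping.single (Poly_Mapping.single i (1::nat)) a =
      Poly_Mapping.single (Poly_Mapping.single j 1) b"
    unfolding cst_X to_ratfun_eq_iff .
  have "Poly_Mapping.lookup (Poly_Mapping.single j (1::nat)) i \<noteq>
      Poly_Mapping.lookup (Poly_Mapping.single i 1) i"
    using assms(1) by (simp add: lookup_single when_def)
  then have "Poly_Mapping.single j (1::nat) \<noteq> Poly_Mapping.single i 1"
    by metis
  with arg_cong[OF *, of "\<lambda>p. Poly_Mapping.lookup p (Poly_Mapping.single i 1)"] assms(2)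
  show False
    by (simp add: lookup_single when_def)
qed

lemma X_nonzero: "X i \<noteq> 0"
  by (metis X_eq pvar_def lookup_single_eq lookup_zero to_ratfun_eq_iff unital_hom.zero[OF to_ratfun_hom] zero_neq_one)

text \<open>Covers permutations and rescalings at once, so that one argument makes
  \<open>rsubst\<close> well defined for both.\<close>

definition monomial_subst :: "(nat \<Rightarrow> ratfun) \<Rightarrow> bool" where
  "monomial_subst \<sigma> \<longleftrightarrow> (\<exists>\<pi> c. bij \<pi> \<and> (\<forall>i. c i \<noteq> 0) \<and> \<sigma> = (\<lambda>i. cst (c i) * X (\<pi> i)))"

text \<open>The substitution is already invertible on polynomials: substituting \<open>s'\<close>
  into the image of \<open>p\<close> gives back \<open>p\<close>.\<close>

lemma psubst_nonzero:
  assumes "monomial_subst \<sigma>" "p \<noteq> 0"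
  shows "psubst \<sigma> p \<noteq> 0"
proof
  obtain \<pi> c where \<pi>: "bij \<pi>" and c: "\<And>i. c i \<noteq> 0" and \<sigma>: "\<sigma> = (\<lambda>i. cst (c i) * X (\<pi> i))"
    using assms(1) by (auto simp: monomial_subst_def)
  define s where "s = (\<lambda>i. pconst (c i) * pvar (\<pi> i))"
  define s' where "s' = (\<lambda>i. pconst (1 / c (inv \<pi> i)) * pvar (inv \<pi> i))"
  have "poly_eval pconst s' (s i) = pvar i" for i
  proof -
    have "poly_eval pconst s' (s i) = pconst (c i) * s' (\<pi> i)"
      unfolding s_def
      by (simp add: unital_hom.poly_eval_mult[OF single_hom] unital_hom.poly_eval_pconst[OF single_hom]
          unital_hom.poly_eval_pvar[OF single_hom])
    also have "\<dots> = pvar i"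
      using \<pi> c by (simp add: s'_def bij_is_inj mult_single flip: mult.assoc)
    finally show ?thesis .
  qed
  moreover have "poly_eval pconst s' (pconst d) = pconst d" for d
    by (rule unital_hom.poly_eval_pconst[OF single_hom])
  ultimately have "poly_eval pconst s' (poly_eval pconst s p) = p"
    unfolding unital_hom.poly_eval[OF unital_hom.poly_eval_hom[OF single_hom]]
    by (simp add: poly_eval_id)
  moreover assume "psubst \<sigma> p = 0"
  then have "to_ratfun (poly_eval pconst s p) = to_ratfun 0"
    unfolding psubst_eq unital_hom.poly_eval[OF to_ratfun_hom] \<sigma> s_def
    by (simp add: cst_eq[abs_def] X_eq unital_hom.mult[OF to_ratfun_hom] unital_hom.zero[OF to_ratfun_hom])
  then have "poly_eval pconst s p = 0"
    by (simp add: to_ratfun_eq_iff)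
  ultimately show False
    using assms(2) by (simp add: poly_eval_def)
qed

lemma psubst_hom: "unital_hom (psubst \<sigma>)"
  unfolding psubst_eq by (rule unital_hom.poly_eval_hom[OF cst_hom])

text \<open>Two representatives agree after cross-multiplication, and \<open>psubst_nonzero\<close>
  permits dividing again; this gives the uniqueness that the definite description demands.\<close>

lemma rsubst_Fract:
  assumes "monomial_subst \<sigma>" "b \<noteq> 0"
  shows "rsubst \<sigma> (Fract a b) = psubst \<sigma> a / psubst \<sigma> b"
  unfolding rsubst_def
proof (rule the_equality)
  show "\<exists>a' b'. b' \<noteq> 0 \<and> Fract a b = Fract a' b' \<and> psubst \<sigma> a / psubst \<sigma> b = psubst \<sigma> a' / psubst \<sigma> b'"
    using assms(2) by blast
next
  fix r assume "\<exists>a' b'. b' \<noteq> 0 \<and> Fract a b = Fract a' b' \<and> r = psubst \<sigma> a' / psubst \<sigma> b'"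
  then obtain a' b' where *: "b' \<noteq> 0" "Fract a b = Fract a' b'" "r = psubst \<sigma> a' / psubst \<sigma> b'"
    by blast
  then have "a * b' = a' * b"
    using assms(2) by (simp add: eq_fract)
  then have "psubst \<sigma> a * psubst \<sigma> b' = psubst \<sigma> a' * psubst \<sigma> b"
    by (simp flip: unital_hom.mult[OF psubst_hom])
  then show "r = psubst \<sigma> a / psubst \<sigma> b"
    using psubst_nonzero[OF assms(1)] assms(2) * by (simp add: frac_eq_eq)
qed

lemma field_endo_rsubst:
  assumes \<sigma>: "monomial_subst \<sigma>"
  shows "field_endo (rsubst \<sigma>)"
proof
  note hom = unital_hom.mult[OF psubst_hom] unital_hom.add[OF psubst_hom] unital_hom.one[OF psubst_hom]
  fix f g :: ratfun
  obtain a b where f: "f = Fract a b" "b \<noteq> 0" by (cases f) auto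
  obtain c d where g: "g = Fract c d" "d \<noteq> 0" by (cases g) auto
  show "rsubst \<sigma> (f + g) = rsubst \<sigma> f + rsubst \<sigma> g"
    using f g psubst_nonzero[OF \<sigma>] by (simp add: rsubst_Fract[OF \<sigma>] hom add_frac_eq)
  show "rsubst \<sigma> (f * g) = rsubst \<sigma> f * rsubst \<sigma> g"
    using f g by (simp add: rsubst_Fract[OF \<sigma>] hom)
  show "rsubst \<sigma> 1 = 1"
    using rsubst_Fract[OF \<sigma>, of 1 1] by (simp add: hom flip: One_fract_def)
qed

lemma rsubst_to_ratfun: "monomial_subst \<sigma> \<Longrightarrow> rsubst \<sigma> (to_ratfun p) = psubst \<sigma> p"
  by (simp add: to_ratfun_def rsubst_Fract unital_hom.one[OF psubst_hom])

lemma rsubst_cst: "monomial_subst \<sigma> \<Longrightarrow> rsubst \<sigma> (cst c) = cst c"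
  by (simp add: cst_eq rsubst_to_ratfun)
    (simp add: psubst_eq unital_hom.poly_eval_pconst[OF cst_hom] cst_eq)

lemma rsubst_X: "monomial_subst \<sigma> \<Longrightarrow> rsubst \<sigma> (X i) = \<sigma> i"
  by (simp add: X_eq rsubst_to_ratfun)
    (simp add: psubst_eq unital_hom.poly_eval_pvar[OF cst_hom])

text \<open>Constants and variables generate the field, so identities between compositions of shifts
  and permutations need checking on these alone.\<close>

lemma field_endo_unique:
  assumes "field_endo \<phi>" "field_endo \<psi>" "\<And>c. \<phi> (cst c) = \<psi> (cst c)" "\<And>i. \<phi> (X i) = \<psi> (X i)"
  shows "\<phi> f = \<psi> f"
proof -
  have hom: "unital_hom \<phi>" "unital_hom \<psi>"
    using assms(1,2) by (simp_all add: field_endo_def unital_hom_def)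
  have *: "\<phi> (to_ratfun p) = \<psi> (to_ratfun p)" for p
    unfolding to_ratfun_poly_eval hom[THEN unital_hom.poly_eval] using assms(3,4) by simp
  obtain a b where "f = Fract a b" "b \<noteq> 0" by (cases f) auto
  then show ?thesis
    using * field_endo.divide[OF assms(1)] field_endo.divide[OF assms(2)] by (simp add: Fract_eq)
qed

section \<open>Rational and symmetric functions of N variables\<close>

lemma polN_mult: "a \<in> polN N \<Longrightarrow> b \<in> polN N \<Longrightarrow> a * b \<in> polN N"
  unfolding polN_def
proof clarify
  fix m i assume *: "\<forall>m\<in>Poly_Mapping.keys a. Poly_Mapping.keys m \<subseteq> {1..N}"
    "\<forall>m\<in>Poly_Mapping.keys b. Poly_Mapping.keys m \<subseteq> {1..N}"
    and m: "m \<in> Poly_Mapping.keys (a * b)" "i \<in> Poly_Mapping.keys m"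
  from keys_mult[of a b] m(1) obtain k l where "m = k + l"
    "k \<in> Poly_Mapping.keys a" "l \<in> Poly_Mapping.keys b"
    by auto
  with * m(2) keys_add[of k l] show "i \<in> {1..N}"
    by blast
qed

lemma polN_add: "a \<in> polN N \<Longrightarrow> b \<in> polN N \<Longrightarrow> a + b \<in> polN N"
  using keys_add[of a b] by (fastforce simp: polN_def)

lemma polN_const: "Poly_Mapping.single 0 c \<in> polN N"
  by (simp add: polN_def)

lemma ratN_add: "f \<in> ratN N \<Longrightarrow> g \<in> ratN N \<Longrightarrow> f + g \<in> ratN N"
  unfolding ratN_def
proof clarify
  fix a b c d assume "a \<in> polN N" "b \<in> polN N" "b \<noteq> 0" "c \<in> polN N" "d \<in> polN N" "d \<noteq> 0"
  then show "\<exists>a' b'. Fract a b + Fract c d = Fract a' b' \<and> a' \<in> polN N \<and> b' \<in> polN N \<and> b' \<noteq> 0"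
    by (intro exI[of _ "a * d + c * b"] exI[of _ "b * d"]) (simp add: polN_add polN_mult)
qed

lemma ratN_mult: "f \<in> ratN N \<Longrightarrow> g \<in> ratN N \<Longrightarrow> f * g \<in> ratN N"
  unfolding ratN_def
proof clarify
  fix a b c d assume "a \<in> polN N" "b \<in> polN N" "b \<noteq> 0" "c \<in> polN N" "d \<in> polN N" "d \<noteq> 0"
  then show "\<exists>a' b'. Fract a b * Fract c d = Fract a' b' \<and> a' \<in> polN N \<and> b' \<in> polN N \<and> b' \<noteq> 0"
    by (intro exI[of _ "a * c"] exI[of _ "b * d"]) (simp add: polN_mult)
qed

lemma ratN_cst: "cst c \<in> ratN N"
  using polN_const[of c N] polN_const[of 1 N] by (force simp: ratN_def cst_def)

lemma ratN_0: "0 \<in> ratN N" and ratN_1: "1 \<in> ratN N"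
  using ratN_cst[of 0 N] ratN_cst[of 1 N] by (simp_all add: unital_hom.zero[OF cst_hom] unital_hom.one[OF cst_hom])

lemma ratN_inverse: "f \<in> ratN N \<Longrightarrow> inverse f \<in> ratN N"
proof (cases "f = 0")
  case False
  assume "f \<in> ratN N"
  then obtain a b where "f = Fract a b" "a \<in> polN N" "b \<in> polN N" "b \<noteq> 0"
    by (auto simp: ratN_def)
  moreover from this False have "a \<noteq> 0"
    by (auto simp: fract_collapse)
  ultimately show ?thesis
    by (auto simp: ratN_def)
qed (simp add: ratN_0)

lemma ratN_uminus: "f \<in> ratN N \<Longrightarrow> - f \<in> ratN N"
  using ratN_mult[OF ratN_cst[of "- 1"], of f N] unital_hom.add[OF cst_hom, of 1 "- 1"]
  by (simp add: unital_hom.zero[OF cst_hom] unital_hom.one[OF cst_hom] add_eq_0_iff)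

lemma ratN_diff: "f \<in> ratN N \<Longrightarrow> g \<in> ratN N \<Longrightarrow> f - g \<in> ratN N"
  using ratN_add[of f N "- g"] ratN_uminus by simp

lemma ratN_divide: "f \<in> ratN N \<Longrightarrow> g \<in> ratN N \<Longrightarrow> f / g \<in> ratN N"
  by (simp add: divide_inverse ratN_mult ratN_inverse)

lemma ratN_sum: "(\<And>x. x \<in> S \<Longrightarrow> f x \<in> ratN N) \<Longrightarrow> sum f S \<in> ratN N"
  by (induction S rule: infinite_finite_induct) (simp_all add: ratN_0 ratN_add)

lemma ratN_prod: "(\<And>x. x \<in> S \<Longrightarrow> f x \<in> ratN N) \<Longrightarrow> prod f S \<in> ratN N"
  by (induction S rule: infinite_finite_induct) (simp_all add: ratN_1 ratN_mult)

lemma ratN_power: "f \<in> ratN N \<Longrightarrow> f ^ n \<in> ratN N"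
  by (induction n) (simp_all add: ratN_1 ratN_mult)

lemma ratN_power_int: "f \<in> ratN N \<Longrightarrow> f powi n \<in> ratN N"
  by (simp add: power_int_def ratN_power ratN_inverse)

lemma ratN_X: "i \<in> {1..N} \<Longrightarrow> X i \<in> ratN N"
proof -
  assume "i \<in> {1..N}"
  then have "Poly_Mapping.single (Poly_Mapping.single i 1) 1 \<in> polN N"
    by (simp add: polN_def)
  then show ?thesis
    using polN_const[of 1 N] by (force simp: ratN_def X_def)
qed

lemmas ratN_intros = ratN_cst ratN_X ratN_sum ratN_prod ratN_power_int ratN_divide ratN_diff ratN_mult

lemma ratN_rsubst:
  assumes \<sigma>: "monomial_subst \<sigma>" and X: "\<And>i. i \<in> {1..N} \<Longrightarrow> \<sigma> i \<in> ratN N" and f: "f \<in> ratN N"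
  shows "rsubst \<sigma> f \<in> ratN N"
proof -
  have "psubst \<sigma> a \<in> ratN N" if "a \<in> polN N" for a
    using that unfolding psubst_def polN_def
    by (intro ratN_sum ratN_mult ratN_prod ratN_power ratN_cst X) blast
  moreover obtain a b where "f = Fract a b" "a \<in> polN N" "b \<in> polN N" "b \<noteq> 0"
    using f by (auto simp: ratN_def)
  ultimately show ?thesis
    by (simp add: rsubst_Fract[OF \<sigma>] ratN_divide)
qed

lemma monomial_subst_scale: "c \<noteq> 0 \<Longrightarrow> monomial_subst (X(i := cst c * X i))"
  unfolding monomial_subst_def
  by (intro exI[of _ id] exI[of _ "(\<lambda>_. 1)(i := c)"]) (auto simp: unital_hom.one[OF cst_hom])

lemma monomial_subst_permute: "bij \<pi> \<Longrightarrow> monomial_subst (\<lambda>i. X (\<pi> i))"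
  unfolding monomial_subst_def
  by (intro exI[of _ \<pi>] exI[of _ "\<lambda>_. 1"]) (auto simp: unital_hom.one[OF cst_hom])

lemma field_endo_shift: "c \<noteq> 0 \<Longrightarrow> field_endo (shift c i)"
  by (simp add: shift_def field_endo_rsubst monomial_subst_scale)

lemma shift_cst: "c \<noteq> 0 \<Longrightarrow> shift c i (cst d) = cst d"
  by (simp add: shift_def rsubst_cst monomial_subst_scale)

lemma shift_X: "c \<noteq> 0 \<Longrightarrow> shift c i (X j) = (if i = j then cst c * X j else X j)"
  by (auto simp: shift_def rsubst_X monomial_subst_scale)

lemma shift_commute: "c \<noteq> 0 \<Longrightarrow> d \<noteq> 0 \<Longrightarrow> shift c i (shift d j f) = shift d j (shift c i f)"
  by (rule field_endo_unique[of "\<lambda>f. shift c i (shift d j f)" "\<lambda>f. shift d j (shift c i f)"])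
    (auto simp: field_endo_comp field_endo_shift shift_cst shift_X
      field_endo.mult[OF field_endo_shift])

lemma field_endo_ident: "field_endo (\<lambda>f. f)"
  by unfold_locales simp_all

lemma shift_inverse: "c \<noteq> 0 \<Longrightarrow> shift c i (shift (1 / c) i f) = f"
  by (rule field_endo_unique[of "\<lambda>f. shift c i (shift (1 / c) i f)" "\<lambda>f. f"])
    (auto simp: field_endo_comp field_endo_shift shift_cst shift_X field_endo_ident
      field_endo.mult[OF field_endo_shift]
      unital_hom.one[OF cst_hom]
      simp flip: mult.assoc unital_hom.mult[OF cst_hom])

lemma permute_shift:
  assumes \<pi>: "\<pi> permutes {1..N}" and c: "c \<noteq> 0"
  shows "rsubst (\<lambda>i. X (\<pi> i)) (shift c i f) = shift c (\<pi> i) (rsubst (\<lambda>i. X (\<pi> i)) f)"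
proof -
  have m: "monomial_subst (\<lambda>i. X (\<pi> i))"
    using \<pi> by (intro monomial_subst_permute permutes_bij)
  have inj: "\<pi> i = \<pi> j \<longleftrightarrow> i = j" for i j
    using permutes_inj[OF \<pi>] by (auto dest: injD)
  show ?thesis
    by (rule field_endo_unique[of "\<lambda>f. rsubst (\<lambda>i. X (\<pi> i)) (shift c i f)"
          "\<lambda>f. shift c (\<pi> i) (rsubst (\<lambda>i. X (\<pi> i)) f)"])
      (auto simp: field_endo_comp field_endo_shift field_endo_rsubst c m shift_cst rsubst_cst
        shift_X rsubst_X field_endo.mult[OF field_endo_rsubst] inj)
qed

text \<open>A permutation carries the summand of index \<open>i\<close> to that of index
  \<open>\<pi> i\<close>, by \<open>permute_shift\<close> and the uniform shape of the coefficients;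
  reindexing restores the sum.\<close>

lemma symN_mac_D:
  assumes f: "f \<in> symN N" and c: "c \<noteq> 0"
  shows "mac_D N c s n f \<in> symN N"
  unfolding symN_def
proof (intro CollectI conjI allI impI)
  have "shift c i f \<in> ratN N" if "i \<in> {1..N}" for i
    unfolding shift_def using that f
    by (intro ratN_rsubst monomial_subst_scale c) (auto simp: symN_def intro!: ratN_intros)
  then show "mac_D N c s n f \<in> ratN N"
    unfolding mac_D_def by (intro ratN_intros) auto
next
  fix \<pi> assume \<pi>: "\<pi> permutes {1..N}"
  define \<phi> where "\<phi> = rsubst (\<lambda>i. X (\<pi> i))"
  have m: "monomial_subst (\<lambda>i. X (\<pi> i))"
    using \<pi> by (intro monomial_subst_permute permutes_bij)
  have \<phi>_X: "\<phi> (X i) = X (\<pi> i)" for i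
    by (simp add: \<phi>_def rsubst_X m)
  have \<phi>_cst: "\<phi> (cst d) = cst d" for d
    by (simp add: \<phi>_def rsubst_cst m)
  have \<phi>_shift: "\<phi> (shift c i f) = shift c (\<pi> i) f" for i
    using f \<pi> by (simp add: \<phi>_def permute_shift[OF \<pi> c] symN_def)
  have hom: "field_endo \<phi>"
    unfolding \<phi>_def by (rule field_endo_rsubst[OF m])
  define h where "h = (\<lambda>i j. (cst s * X i - cst (1 / s) * X j) / (X i - X j))"
  have D_eq: "mac_D N c s n f = (\<Sum>i = 1..N. X i powi n * (\<Prod>j\<in>{1..N} - {i}. h i j) * shift c i f)"
    by (simp add: mac_D_def h_def)
  have \<phi>_h: "\<phi> (h i j) = h (\<pi> i) (\<pi> j)" for i j
    by (simp add: h_def field_endo.hom_simps[OF hom] \<phi>_X \<phi>_cst)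
  have prod: "(\<Prod>j\<in>{1..N} - {i}. h (\<pi> i) (\<pi> j)) = (\<Prod>j\<in>{1..N} - {\<pi> i}. h (\<pi> i) j)" if "i \<in> {1..N}" for i
  proof (rule prod.reindex_bij_betw)
    have "\<pi> i \<in> {1..N}"
      using permutes_in_image[OF \<pi>] that by blast
    then show "bij_betw \<pi> ({1..N} - {i}) ({1..N} - {\<pi> i})"
      using permutes_imp_bij[OF \<pi>] that by (intro bij_betw_DiffI) auto
  qed
  have "\<phi> (mac_D N c s n f) = (\<Sum>i = 1..N. X (\<pi> i) powi n * (\<Prod>j\<in>{1..N} - {i}. h (\<pi> i) (\<pi> j)) * shift c (\<pi> i) f)"
    unfolding D_eq field_endo.sum[OF hom] field_endo.prod[OF hom] field_endo.mult[OF hom]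
      field_endo.power_int[OF hom] \<phi>_X \<phi>_h \<phi>_shift ..
  also have "\<dots> = (\<Sum>i = 1..N. X (\<pi> i) powi n * (\<Prod>j\<in>{1..N} - {\<pi> i}. h (\<pi> i) j) * shift c (\<pi> i) f)"
    by (intro sum.cong refl) (simp only: prod)
  also have "\<dots> = (\<Sum>i = 1..N. X i powi n * (\<Prod>j\<in>{1..N} - {i}. h i j) * shift c i f)"
    by (rule sum.reindex_bij_betw[OF permutes_imp_bij[OF \<pi>]])
  also have "\<dots> = mac_D N c s n f"
    by (rule D_eq[symmetric])
  finally show "rsubst (\<lambda>i. X (\<pi> i)) (mac_D N c s n f) = mac_D N c s n f"
    unfolding \<phi>_def .
qed

lemma symN_cst_mult: "f \<in> symN N \<Longrightarrow> cst c * f \<in> symN N"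
  unfolding symN_def
proof (intro CollectI conjI allI impI)
  fix \<pi> assume f: "f \<in> {f \<in> ratN N. \<forall>\<pi>. \<pi> permutes {1..N} \<longrightarrow> rsubst (\<lambda>i. X (\<pi> i)) f = f}"
    and \<pi>: "\<pi> permutes {1..N}"
  then have m: "monomial_subst (\<lambda>i. X (\<pi> i))"
    by (intro monomial_subst_permute permutes_bij)
  then show "rsubst (\<lambda>i. X (\<pi> i)) (cst c * f) = cst c * f"
    using f \<pi> by (simp add: field_endo.mult[OF field_endo_rsubst] rsubst_cst)
qed (auto intro: ratN_mult ratN_cst)

lemma symN_diff: "f \<in> symN N \<Longrightarrow> g \<in> symN N \<Longrightarrow> f - g \<in> symN N"
  unfolding symN_def
proof (intro CollectI conjI allI impI)
  fix \<pi> assume f: "f \<in> {f \<in> ratN N. \<forall>\<pi>. \<pi> permutes {1..N} \<longrightarrow> rsubst (\<lambda>i. X (\<pi> i)) f = f}"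
    "g \<in> {f \<in> ratN N. \<forall>\<pi>. \<pi> permutes {1..N} \<longrightarrow> rsubst (\<lambda>i. X (\<pi> i)) f = f}"
    and \<pi>: "\<pi> permutes {1..N}"
  then have m: "monomial_subst (\<lambda>i. X (\<pi> i))"
    by (intro monomial_subst_permute permutes_bij)
  then show "rsubst (\<lambda>i. X (\<pi> i)) (f - g) = f - g"
    using f \<pi> by (simp add: field_endo.diff[OF field_endo_rsubst])
qed (auto intro: ratN_diff)

section \<open>The Macdonald currents\<close>

lemma qh_nonzero: "qh \<noteq> 0" and th_nonzero: "th \<noteq> 0"
  by (simp_all add: qh_def th_def Zero_fract_def eq_fract)

lemma qq_nonzero: "qq \<noteq> 0" and tt_nonzero: "tt \<noteq> 0"
  by (simp_all add: qq_def tt_def qh_nonzero th_nonzero)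

lemma qq_neq_1: "qq \<noteq> 1" and tt_neq_1: "tt \<noteq> 1" and tt_neq_qq: "tt \<noteq> qq"
  by (simp_all add: qq_def tt_def qh_def th_def One_fract_def eq_fract power2_eq_square one_pCons)

lemma six_nonzero_ratfun: "(6::ratfun) \<noteq> 0"
proof -
  have "(of_nat 6::qtfield) \<noteq> 0"
    unfolding of_nat_fract Zero_fract_def by (subst eq_fract) simp_all
  then have "cst (of_nat 6) \<noteq> 0"
    by (rule cst_nonzero)
  then show ?thesis
    unfolding unital_hom.of_nat[OF cst_hom] by simp
qed

lemmas cst_hom_simps = unital_hom.add[OF cst_hom] unital_hom.mult[OF cst_hom] unital_hom.one[OF cst_hom]
  unital_hom.zero[OF cst_hom] unital_hom.power[OF cst_hom]

lemma cst_inverse: "cst (inverse a) = inverse (cst a)"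
proof (cases "a = 0")
  case False
  then have "cst a * cst (inverse a) = 1"
    by (simp flip: cst_hom_simps)
  then show ?thesis
    by (metis inverse_unique)
qed (simp add: cst_hom_simps)

lemma cst_divide: "cst (a / b) = cst a / cst b"
  by (simp add: divide_inverse cst_hom_simps cst_inverse)

lemma cst_minus: "cst (- a) = - cst a"
  using unital_hom.add[OF cst_hom, of a "- a"] by (simp add: cst_hom_simps eq_neg_iff_add_eq_0 add.commute)

lemma cst_diff: "cst (a - b) = cst a - cst b"
  using unital_hom.add[OF cst_hom, of a "- b"] by (simp add: cst_minus)

lemma cst_power_int: "cst (a powi n) = cst a powi n"
  by (simp add: power_int_def cst_hom_simps cst_inverse)

lemmas cst_simps = cst_hom_simps cst_divide cst_diff cst_power_int

lemma shift_system_ratfun: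
  assumes nz: "h \<noteq> 0" "q \<noteq> 0" "s \<noteq> 0"
  shows "shift_system {1..N} (\<lambda>i. cst h * X i) (cst q) (cst s) (cst C) (shift q)"
proof (rule shift_system.intro)
  fix i j :: nat and f
  show "finite {1..N}" by simp
  show "field_endo (shift q i)"
    by (rule field_endo_shift) fact
  then show "shift q i (cst h * X j) = (if i = j then cst q * (cst h * X j) else cst h * X j)"
    using nz by (simp add: field_endo.mult shift_cst shift_X)
  show "shift q i (cst q) = cst q" "shift q i (cst s) = cst s" "shift q i (cst C) = cst C"
    using nz by (simp_all add: shift_cst)
  show "shift q i (shift q j f) = shift q j (shift q i f)"
    by (rule shift_commute) fact+
  show "cst h * X i \<noteq> 0" "cst q \<noteq> 0" "cst s \<noteq> 0"
    using nz by (simp_all add: cst_nonzero X_nonzero)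
  assume "i \<noteq> j"
  then show "cst h * X i \<noteq> cst h * X j"
    using nz by (intro cst_X_neq)
  show "cst h * X i \<noteq> cst q * (cst h * X j)"
    unfolding mult.assoc[symmetric] cst_hom_simps(2)[symmetric]
    by (rule cst_X_neq) fact+
qed (rule six_nonzero_ratfun)

text \<open>The factor \<open>h powi n\<close> is absorbed into the n-th powers of the rescaled
  variables, and the coefficients are insensitive to the rescaling.\<close>

lemma mac_D_eq:
  assumes "h \<noteq> 0"
  shows "cst (C * h powi n) * mac_D N c s n f =
    mac_current {1..N} (\<lambda>i. cst h * X i) (cst s) (cst C) (shift c) n f"
proof -
  have "mac_coeff {1..N} (\<lambda>i. cst h * X i) (cst s) i =
      (\<Prod>j\<in>{1..N} - {i}. (cst s * X i - cst (1 / s) * X j) / (X i - X j))" for i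
    unfolding mac_coeff_def mac_prod_def mac_ratio_scale[OF cst_nonzero[OF assms]]
    by (simp add: mac_ratio_def cst_simps)
  then show ?thesis
    by (simp add: mac_D_def mac_current_def cst_simps power_int_mult_distrib sum_distrib_left mult_ac)
qed

interpretation mac: shift_pair "{1..N}" "\<lambda>i. cst qh * X i" "cst qq" "cst th" "cst (qh / (1 - qq))" "shift qq"
  "cst ((1 / qh) / (1 - 1 / qq))" "shift (1 / qq)" for N
proof -
  \<comment> \<open>Since \<open>qq = qh ^ 2\<close>, dividing \<open>qh\<close> by
    \<open>qq\<close> gives \<open>1 / qh\<close>, the scale that occurs in
    \<open>cur_f\<close>.\<close>
  have "cst qh * X i / cst qq = cst (1 / qh) * X i" for i
    using cst_nonzero[OF qh_nonzero] by (simp add: cst_simps qq_def power2_eq_square)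
  moreover have "1 / cst qq = cst (1 / qq)" "1 / cst th = cst (1 / th)"
    by (simp_all add: cst_simps)
  ultimately have inv: "shift_system {1..N} (\<lambda>i. cst qh * X i / cst qq) (1 / cst qq) (1 / cst th)
      (cst ((1 / qh) / (1 - 1 / qq))) (shift (1 / qq))"
    by (simp only:) (rule shift_system_ratfun, simp_all add: qh_nonzero qq_nonzero th_nonzero)
  show "shift_pair {1..N} (\<lambda>i. cst qh * X i) (cst qq) (cst th) (cst (qh / (1 - qq))) (shift qq)
      (cst ((1 / qh) / (1 - 1 / qq))) (shift (1 / qq))"
  proof (intro shift_pair.intro shift_pair_axioms.intro)
    show "shift_system {1..N} (\<lambda>i. cst qh * X i) (cst qq) (cst th) (cst (qh / (1 - qq))) (shift qq)"
      by (rule shift_system_ratfun[OF qh_nonzero qq_nonzero th_nonzero])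
    show "shift_system {1..N} (\<lambda>i. cst qh * X i / cst qq) (1 / cst qq) (1 / cst th)
      (cst ((1 / qh) / (1 - 1 / qq))) (shift (1 / qq))"
      by (rule inv)
    show "shift qq i (shift (1 / qq) i f) = f" "shift (1 / qq) i (shift qq i f) = f" for i f
      using shift_inverse[of qq i f] shift_inverse[of "1 / qq" i f] qq_nonzero by simp_all
    show "shift qq i (shift (1 / qq) j f) = shift (1 / qq) j (shift qq i f)" for i j f
      by (rule shift_commute) (simp_all add: qq_nonzero)
    show "shift qq i (cst ((1 / qh) / (1 - 1 / qq))) = cst ((1 / qh) / (1 - 1 / qq))"
      "shift (1 / qq) i (cst (qh / (1 - qq))) = cst (qh / (1 - qq))" for i
      by (simp_all add: shift_cst qq_nonzero)
    show "cst qq \<noteq> 1"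
      using qq_neq_1 cst_inject[of qq 1] by (simp add: cst_simps)
  qed
qed

lemma cur_e_eq: "cur_e N n f = mac.E N n f"
  unfolding cur_e_def by (rule mac_D_eq[OF qh_nonzero])

lemma cur_f_eq: "cur_f N n f = mac.F N n f"
proof -
  have "cst qh * X i / cst qq = cst (1 / qh) * X i" for i
    using cst_nonzero[OF qh_nonzero] by (simp add: cst_simps qq_def power2_eq_square)
  moreover have "qh powi (- n) = (1 / qh) powi n"
    by (simp add: power_int_minus power_int_one_over inverse_eq_divide)
  ultimately show ?thesis
    using mac_D_eq[of "1 / qh" "(1 / qh) / (1 - 1 / qq)" n N "1 / qq" "1 / th" f] qh_nonzero
    by (simp add: cur_f_def cst_simps)
qed

lemma psi_fps_eq: "psi_fps N u = psi_series {1..N} (cst qq) (cst th ^ 2) (\<lambda>i. cst qh * u i)"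
  unfolding psi_fps_def psi_series_def
proof (intro prod.cong refl)
  fix i
  have c: "cst th ^ 2 / cst qq * (cst qh * u i) = cst (tt / qh) * u i"
    "cst qh * u i / cst th ^ 2 = cst (qh / tt) * u i" "cst qh * u i / cst qq = cst (1 / qh) * u i"
    using cst_nonzero[OF qh_nonzero] by (simp_all add: cst_simps qq_def tt_def power2_eq_square)
  show "(1 - fps_const (cst (tt / qh) * u i) * fps_X) * (1 - fps_const (cst (qh / tt) * u i) * fps_X) /
     ((1 - fps_const (cst (1 / qh) * u i) * fps_X) * (1 - fps_const (cst qh * u i) * fps_X)) =
    fps_lin (cst th ^ 2 / cst qq * (cst qh * u i)) * fps_lin (cst qh * u i / cst th ^ 2) /
    (fps_lin (cst qh * u i) * fps_lin (cst qh * u i / cst qq))"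
    unfolding c fps_lin_def by (simp only: mult.commute)
qed

lemma psi_plus_coeff_eq:
  "psi_plus_coeff N n = fps_coeff_int (psi_series {1..N} (cst qq) (cst th ^ 2) (\<lambda>i. cst qh * X i)) n"
  by (simp add: psi_plus_coeff_def fps_coeff_int_def psi_fps_eq)

lemma psi_minus_coeff_eq:
  "psi_minus_coeff N n =
    fps_coeff_int (psi_series {1..N} (cst qq) (cst th ^ 2) (\<lambda>i. cst qq / (cst qh * X i))) (- n)"
proof -
  have "cst qq / (cst qh * X i) = cst qh * inverse (X i)" for i
    using cst_nonzero[OF qh_nonzero] by (simp add: cst_simps qq_def power2_eq_square divide_inverse)
  then show ?thesis
    by (simp add: psi_minus_coeff_def fps_coeff_int_def psi_fps_eq)
qed

lemma g_one_one_cst: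
  "cst (1 / g_one_one) = 1 / ((1 - cst qq) * (1 - 1 / cst th ^ 2) * (1 - cst th ^ 2 / cst qq))"
  by (simp add: g_one_one_def gpol_def cst_simps tt_def)

lemma g_one_one_nonzero: "g_one_one \<noteq> 0"
  using qq_neq_1 tt_neq_1 tt_neq_qq tt_nonzero qq_nonzero by (simp add: g_one_one_def gpol_def)

lemma commutator_e_f:
  "cur_e N m (cur_f N n f) - cur_f N n (cur_e N m f) =
    cst (1 / g_one_one) * (psi_plus_coeff N (m + n) - psi_minus_coeff N (m + n)) * f"
  unfolding cur_e_eq cur_f_eq psi_plus_coeff_eq psi_minus_coeff_eq g_one_one_cst
proof (rule mac.commutator_relation)
  have "(1 / qh / (1 - 1 / qq)) * (qh / (1 - qq)) = 1 / ((1 - qq) * (1 - 1 / qq))"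
    using qh_nonzero by simp
  then show "cst (qh / (1 - qq)) * cst (1 / qh / (1 - 1 / qq)) = 1 / ((1 - cst qq) * (1 - 1 / cst qq))"
    unfolding cst_hom_simps(2)[symmetric] by (simp add: cst_simps mult.commute)
  show "cst th ^ 2 \<noteq> 1"
    using tt_neq_1 cst_inject[of tt 1] by (simp add: cst_simps tt_def)
  show "cst th ^ 2 \<noteq> cst qq"
    using tt_neq_qq cst_inject[of tt qq] by (simp add: cst_simps tt_def)
qed

section \<open>Multiplication of series by g\<close>

lemma laurent_mult_add:
  "laurent_mult (p + p') S \<alpha> f = laurent_mult p S \<alpha> f + laurent_mult p' S \<alpha> f"
proof -
  have superset: "laurent_mult r S \<alpha> f = (\<Sum>\<beta>\<in>B. cst (Poly_Mapping.lookup r \<beta>) * S (\<alpha> - \<beta>) f)"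
    if "finite B" "Poly_Mapping.keys r \<subseteq> B" for r B
    unfolding laurent_mult_def using that
    by (intro sum.mono_neutral_left) (auto simp: in_keys_iff cst_simps)
  let ?B = "Poly_Mapping.keys p \<union> Poly_Mapping.keys p'"
  have "laurent_mult (p + p') S \<alpha> f = (\<Sum>\<beta>\<in>?B. cst (Poly_Mapping.lookup (p + p') \<beta>) * S (\<alpha> - \<beta>) f)"
    by (rule superset) (use keys_add[of p p'] in auto)
  then show ?thesis
    by (simp add: superset[of ?B] lookup_add cst_simps distrib_right sum.distrib)
qed

lemma laurent_mult_single:
  "laurent_mult (Poly_Mapping.single \<beta> c) S \<alpha> f = cst c * S (\<alpha> - \<beta>) f"
  by (simp add: laurent_mult_def cst_simps)

lemma gpol_expand:
  fixes z w :: "'a::comm_ring_1"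
  assumes "unital_hom \<iota>"
  shows "gpol \<iota> z w = z^3 + \<iota> (- gcoef1 qq tt) * (z^2 * w) + \<iota> (gcoef2 qq tt) * (z * w^2) + \<iota> (- 1) * w^3"
proof -
  interpret unital_hom \<iota> by fact
  have c: "gcoef2 qq tt = qq * (1 / tt) + qq * (tt / qq) + 1 / tt * (tt / qq)"
    "qq * (1 / tt) * (tt / qq) = 1"
    using qq_nonzero tt_nonzero by (simp_all add: gcoef2_def)
  have minus: "\<iota> (- a) = - \<iota> a" for a
    using add[of a "- a"] by (simp add: zero eq_neg_iff_add_eq_0 add.commute)
  have 1: "\<iota> qq * \<iota> (1 / tt) * \<iota> (tt / qq) = 1"
    unfolding mult[symmetric] c(2) by (rule one)
  have 2: "\<iota> (gcoef2 qq tt) = \<iota> qq * \<iota> (1 / tt) + \<iota> qq * \<iota> (tt / qq) + \<iota> (1 / tt) * \<iota> (tt / qq)"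
    unfolding c(1) add mult ..
  have 3: "\<iota> (gcoef1 qq tt) = \<iota> qq + \<iota> (1 / tt) + \<iota> (tt / qq)"
    unfolding gcoef1_def add ..
  have "gpol \<iota> z w = z^3 - (\<iota> qq + \<iota> (1 / tt) + \<iota> (tt / qq)) * (z^2 * w) +
      (\<iota> qq * \<iota> (1 / tt) + \<iota> qq * \<iota> (tt / qq) + \<iota> (1 / tt) * \<iota> (tt / qq)) * (z * w^2) -
      (\<iota> qq * \<iota> (1 / tt) * \<iota> (tt / qq)) * w^3"
    unfolding gpol_def by (simp add: algebra_simps power2_eq_square power3_eq_cube)
  then show ?thesis
    unfolding 1 minus 2 3 one by (simp add: algebra_simps)
qed

lemma zvar_wvar_power: "zvar ^ n = Poly_Mapping.single (int n, 0) 1" "wvar ^ n = Poly_Mapping.single (0, int n) 1"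
  by (induction n) (simp_all add: zvar_def wvar_def mult_single flip: zero_prod_def)

lemma zvar_wvar_mult: "zvar ^ m * wvar ^ n = Poly_Mapping.single (int m, int n) 1"
  by (simp add: zvar_wvar_power mult_single)

lemma g_zw_expand:
  "g_zw = Poly_Mapping.single (3, 0) 1 + Poly_Mapping.single (2, 1) (- gcoef1 qq tt) +
    Poly_Mapping.single (1, 2) (gcoef2 qq tt) + Poly_Mapping.single (0, 3) (- 1)"
  "g_wz = Poly_Mapping.single (0, 3) 1 + Poly_Mapping.single (1, 2) (- gcoef1 qq tt) +
    Poly_Mapping.single (2, 1) (gcoef2 qq tt) + Poly_Mapping.single (3, 0) (- 1)"
  unfolding g_zw_def g_wz_def gpol_expand[OF single_hom]
  using zvar_wvar_mult[of 2 1] zvar_wvar_mult[of 1 2] zvar_wvar_power(1)[of 3] zvar_wvar_power(2)[of 3]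
  by (simp_all add: mult_single mult.commute[of wvar] mult.commute[of "wvar ^ 2"])

abbreviation "\<gamma>\<^sub>1 \<equiv> gcoef1 (cst qq) (cst th ^ 2)"
abbreviation "\<gamma>\<^sub>2 \<equiv> gcoef2 (cst qq) (cst th ^ 2)"

lemma cst_coef: "cst (gcoef1 qq tt) = \<gamma>\<^sub>1" "cst (gcoef2 qq tt) = \<gamma>\<^sub>2"
  by (simp_all add: gcoef1_def gcoef2_def cst_simps tt_def)

lemma laurent_mult_g:
  "laurent_mult g_zw S (m, n) f = S (m - 3, n) f - \<gamma>\<^sub>1 * S (m - 2, n - 1) f + \<gamma>\<^sub>2 * S (m - 1, n - 2) f - S (m, n - 3) f"
  "laurent_mult g_wz S (m, n) f = S (m, n - 3) f - \<gamma>\<^sub>1 * S (m - 1, n - 2) f + \<gamma>\<^sub>2 * S (m - 2, n - 1) f - S (m - 3, n) f"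
  unfolding g_zw_expand laurent_mult_add laurent_mult_single cst_coef[symmetric]
  by (simp_all add: cst_simps cst_minus)

text \<open>Inverting the parameters exchanges the two middle coefficients and so turns g(z,w) into
  - g(w,z); hence the exchanged arguments of g in the relations for f.\<close>

lemma coef_inverse: "gcoef1 (1 / q) ((1 / s)^2) = gcoef2 q (s^2)" "gcoef2 (1 / q) ((1 / s)^2) = gcoef1 q (s^2)"
  for q s :: "'a::field"
  by (simp_all add: gcoef1_def gcoef2_def power_one_over divide_simps)

section \<open>Recurrences for the coefficients of psi under the shifts\<close>

lemma psi_recurrence:
  assumes "i \<in> {1..N}" and p: "p \<in> {psi_plus_coeff N, psi_minus_coeff N}"
  shows "shift qq i (p n) - \<gamma>\<^sub>1 * (cst qh * X i) * shift qq i (p (n - 1)) +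
      \<gamma>\<^sub>2 * (cst qh * X i)^2 * shift qq i (p (n - 2)) - (cst qh * X i)^3 * shift qq i (p (n - 3)) =
    p n - \<gamma>\<^sub>2 * (cst qh * X i) * p (n - 1) + \<gamma>\<^sub>1 * (cst qh * X i)^2 * p (n - 2) - (cst qh * X i)^3 * p (n - 3)"
proof -
  let ?u = "\<lambda>i. cst qh * X i" and ?u' = "\<lambda>j. shift qq i (cst qh * X j)"
  note hom = mac.endo[of i]
  have u': "?u' j = ?u j" if "j \<in> {1..N} - {i}" for j
    using that mac.G_y by auto
  have ui: "?u' i = cst qq * ?u i"
    using mac.G_y by simp
  have fix_qt: "shift qq i (cst qq) = cst qq" "shift qq i (cst th ^ 2) = cst th ^ 2"
    using mac.G_q mac.G_s by (simp_all add: field_endo.power[OF hom])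
  have t: "cst th ^ 2 \<noteq> 0"
    using mac.s_nonzero by simp
  have shift_psi: "shift qq i (fps_coeff_int (psi_series {1..N} (cst qq) (cst th ^ 2) v) k) =
      fps_coeff_int (psi_series {1..N} (cst qq) (cst th ^ 2) (\<lambda>j. shift qq i (v j))) k" for v k
    by (simp add: field_endo.fps_map_psi_series[OF hom fix_qt] flip: field_endo.fps_coeff_int_map[OF hom])
  consider "p = psi_plus_coeff N" | "p = psi_minus_coeff N"
    using p by auto
  then show ?thesis
  proof cases
    case 1
    show ?thesis
      unfolding 1 psi_plus_coeff_eq shift_psi
      by (rule psi_series_recurrence[of "{1..N}" i "cst qq" "cst th ^ 2" ?u' ?u,
            OF _ assms(1) mac.q_nonzero t u' ui]) auto
  next
    case 2
    have "shift qq i (cst qq / ?u j) = cst qq / ?u' j" for j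
      by (simp add: field_endo.divide[OF hom] fix_qt)
    then show ?thesis
      unfolding 2 psi_minus_coeff_eq shift_psi
      using psi_series_recurrence_inverse[of "{1..N}" i "cst qq" "cst th ^ 2" ?u' ?u n,
          OF _ assms(1) mac.q_nonzero t u' ui mac.y_nonzero] by simp
  qed
qed

text \<open>Applying the inverse shift to \<open>psi_recurrence\<close> removes the shifts on its
  left side, creates them on its right side, and turns \<open>cst qh * X i\<close> into
  \<open>y\<close>. The claim is the result read from right to left.\<close>

lemma psi_recurrence_inverse:
  assumes "i \<in> {1..N}" and p: "p \<in> {psi_plus_coeff N, psi_minus_coeff N}"
  defines "y \<equiv> cst qh * X i / cst qq" and "H \<equiv> shift (1 / qq) i"
  shows "H (p n) - \<gamma>\<^sub>2 * y * H (p (n - 1)) + \<gamma>\<^sub>1 * y^2 * H (p (n - 2)) - y^3 * H (p (n - 3)) =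
    p n - \<gamma>\<^sub>1 * y * p (n - 1) + \<gamma>\<^sub>2 * y^2 * p (n - 2) - y^3 * p (n - 3)"
proof -
  have hom: "field_endo H"
    unfolding H_def by (rule mac.inv.endo)
  have H_G: "H (shift qq i f) = f" for f
    unfolding H_def by (rule mac.H_G)
  have H_y: "H (cst qh) * H (X i) = y"
    unfolding field_endo.mult[OF hom, symmetric] unfolding H_def y_def using mac.H_y[of i i] by simp
  have H_c: "H \<gamma>\<^sub>1 = \<gamma>\<^sub>1" "H \<gamma>\<^sub>2 = \<gamma>\<^sub>2"
    unfolding gcoef1_def gcoef2_def
    using mac.H_q[of i] mac.H_s[of i] field_endo.hom_simps[OF hom]
    by (simp_all add: H_def)
  have "H (shift qq i (p n) - \<gamma>\<^sub>1 * (cst qh * X i) * shift qq i (p (n - 1)) +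
      \<gamma>\<^sub>2 * (cst qh * X i)^2 * shift qq i (p (n - 2)) - (cst qh * X i)^3 * shift qq i (p (n - 3))) =
    H (p n - \<gamma>\<^sub>2 * (cst qh * X i) * p (n - 1) + \<gamma>\<^sub>1 * (cst qh * X i)^2 * p (n - 2) - (cst qh * X i)^3 * p (n - 3))"
    by (rule arg_cong[OF psi_recurrence[OF assms(1,2)]])
  then show ?thesis
    unfolding field_endo.add[OF hom] field_endo.diff[OF hom] field_endo.mult[OF hom]
      field_endo.power[OF hom] H_G H_y H_c by (rule sym)
qed

section \<open>The relations as identities of formal series\<close>

lemma e_e_relation:
  "ser_eq N (g_zw \<odot>\<^sub>s prod_zw (cur_e N) (cur_e N) \<oplus>\<^sub>s g_wz \<odot>\<^sub>s prod_wz (cur_e N) (cur_e N)) ser_zero"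
proof -
  have "laurent_mult g_zw (prod_zw (cur_e N) (cur_e N)) (m, n) f +
    laurent_mult g_wz (prod_wz (cur_e N) (cur_e N)) (m, n) f = 0" for m n f
    using mac.quadratic_relation[of N m n f]
    unfolding laurent_mult_g by (simp add: prod_zw_def prod_wz_def cur_e_eq)
  then show ?thesis
    by (simp add: ser_eq_def ser_add_def ser_zero_def)
qed

lemma f_f_relation:
  "ser_eq N (g_wz \<odot>\<^sub>s prod_zw (cur_f N) (cur_f N) \<oplus>\<^sub>s g_zw \<odot>\<^sub>s prod_wz (cur_f N) (cur_f N)) ser_zero"
proof -
  have "laurent_mult g_wz (prod_zw (cur_f N) (cur_f N)) (m, n) f +
    laurent_mult g_zw (prod_wz (cur_f N) (cur_f N)) (m, n) f = 0" for m n f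
    using mac.inv.quadratic_relation[of N m n f]
    unfolding coef_inverse laurent_mult_g
    by (simp add: prod_zw_def prod_wz_def cur_f_eq algebra_simps)
  then show ?thesis
    by (simp add: ser_eq_def ser_add_def ser_zero_def)
qed

lemma psi_relations:
  assumes p: "p \<in> {psi_plus_coeff N, psi_minus_coeff N}"
  defines "\<psi> \<equiv> \<lambda>n f. p n * f"
  shows "ser_eq N (g_zw \<odot>\<^sub>s prod_zw \<psi> (cur_e N) \<oplus>\<^sub>s g_wz \<odot>\<^sub>s prod_wz (cur_e N) \<psi>) ser_zero"
    and "ser_eq N (g_wz \<odot>\<^sub>s prod_zw \<psi> (cur_f N) \<oplus>\<^sub>s g_zw \<odot>\<^sub>s prod_wz (cur_f N) \<psi>) ser_zero"
proof -
  have "laurent_mult g_zw (prod_zw \<psi> (cur_e N)) (m, n) f +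
    laurent_mult g_wz (prod_wz (cur_e N) \<psi>) (m, n) f = 0" for m n f
    using mac.psi_relation[of N p m n f] psi_recurrence[OF _ p] unfolding laurent_mult_g
    by (simp add: prod_zw_def prod_wz_def cur_e_eq \<psi>_def)
  then show "ser_eq N (g_zw \<odot>\<^sub>s prod_zw \<psi> (cur_e N) \<oplus>\<^sub>s g_wz \<odot>\<^sub>s prod_wz (cur_e N) \<psi>) ser_zero"
    by (simp add: ser_eq_def ser_add_def ser_zero_def)
  have "laurent_mult g_wz (prod_zw \<psi> (cur_f N)) (m, n) f +
    laurent_mult g_zw (prod_wz (cur_f N) \<psi>) (m, n) f = 0" for m n f
    using mac.inv.psi_relation[of N p m n f, unfolded coef_inverse, OF psi_recurrence_inverse[OF _ p]]
    unfolding laurent_mult_g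
    by (simp add: prod_zw_def prod_wz_def cur_f_eq \<psi>_def algebra_simps)
  then show "ser_eq N (g_wz \<odot>\<^sub>s prod_zw \<psi> (cur_f N) \<oplus>\<^sub>s g_zw \<odot>\<^sub>s prod_wz (cur_f N) \<psi>) ser_zero"
    by (simp add: ser_eq_def ser_add_def ser_zero_def)
qed

lemma e_f_relation:
  "ser_eq N (prod_zw (cur_e N) (cur_f N) \<ominus>\<^sub>s prod_wz (cur_f N) (cur_e N))
    (Poly_Mapping.single 0 (1 / g_one_one) \<odot>\<^sub>s delta_mult (psi_plus N \<ominus>\<^sub>s psi_minus N))"
proof -
  have "laurent_mult (Poly_Mapping.single 0 (1 / g_one_one)) (delta_mult (psi_plus N \<ominus>\<^sub>s psi_minus N)) (m, n) f =
      cst (1 / g_one_one) * (psi_plus_coeff N (m + n) - psi_minus_coeff N (m + n)) * f" for m n f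
    by (simp add: laurent_mult_single delta_mult_def ser_diff_def psi_plus_def psi_minus_def algebra_simps)
  moreover have "(prod_zw (cur_e N) (cur_f N) \<ominus>\<^sub>s prod_wz (cur_f N) (cur_e N)) (m, n) f =
      cst (1 / g_one_one) * (psi_plus_coeff N (m + n) - psi_minus_coeff N (m + n)) * f" for m n f
    by (simp add: ser_diff_def prod_zw_def prod_wz_def commutator_e_f)
  ultimately show ?thesis
    by (simp only: ser_eq_def split_paired_All) simp
qed

lemma e_serre: "ser_eq N (sym3 (z2_over_z3 \<odot>\<^sub>s double_comm (cur_e N))) ser_zero"
proof -
  have "laurent_mult z2_over_z3 (double_comm (cur_e N)) (a, b, c) f = mac.E_bracket N a (b - 1) (c + 1) f" for a b c f
    unfolding z2_over_z3_def laurent_mult_single mac.E_bracket_def cur_e_eq[symmetric]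
    by (simp add: double_comm_def comm_op_def unital_hom.one[OF cst_hom])
  then show ?thesis
    using mac.serre_relation[of N] by (simp add: ser_eq_def sym3_def ser_zero_def)
qed

lemma f_serre: "ser_eq N (sym3 (z2_over_z3 \<odot>\<^sub>s double_comm (cur_f N))) ser_zero"
proof -
  have "laurent_mult z2_over_z3 (double_comm (cur_f N)) (a, b, c) f = mac.inv.E_bracket N a (b - 1) (c + 1) f" for a b c f
    unfolding z2_over_z3_def laurent_mult_single mac.inv.E_bracket_def cur_f_eq[symmetric]
    by (simp add: double_comm_def comm_op_def unital_hom.one[OF cst_hom])
  then show ?thesis
    using mac.inv.serre_relation[of N] by (simp add: ser_eq_def sym3_def ser_zero_def)
qed

lemma psi_coeff_0: "psi_plus_coeff N 0 = 1" "psi_minus_coeff N 0 = 1"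
  by (simp_all add: psi_plus_coeff_def psi_minus_coeff_def psi_fps_eq psi_series_nth_0)

section \<open>Stability of the symmetric functions\<close>

lemma cur_preserve: "preserves_sym N (cur_e N n)" "preserves_sym N (cur_f N n)"
  by (auto simp: preserves_sym_def cur_e_def cur_f_def qq_nonzero intro!: symN_cst_mult symN_mac_D)

lemma psi_preserve: "preserves_sym N (psi_plus N n)" "preserves_sym N (psi_minus N n)"
proof -
  \<comment> \<open>The coefficient of \<open>\<psi>\<^sup>+ - \<psi>\<^sup>-\<close> is a multiple of \<open>[e\<^sub>n, f\<^sub>0]\<close>, so its symmetry is inherited from the currents.\<close>
  have *: "(psi_plus_coeff N n - psi_minus_coeff N n) * f \<in> symN N" if f: "f \<in> symN N" for f
  proof -
    have "cur_e N n (cur_f N 0 f) - cur_f N 0 (cur_e N n f) \<in> symN N"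
      using f cur_preserve by (intro symN_diff) (auto simp: preserves_sym_def)
    then have "cst g_one_one * (cst (1 / g_one_one) * ((psi_plus_coeff N n - psi_minus_coeff N n) * f)) \<in> symN N"
      unfolding commutator_e_f by (intro symN_cst_mult[of "cst (1 / g_one_one) * _"]) (simp only: mult.assoc add_0_right)
    moreover have "cst g_one_one * cst (1 / g_one_one) = 1"
      using g_one_one_nonzero by (simp add: unital_hom.one[OF cst_hom] flip: unital_hom.mult[OF cst_hom])
    ultimately show ?thesis
      by (simp only: mult.assoc[symmetric] mult_1_left)
  qed
  have zero: "0 * f \<in> symN N" and one: "1 * f \<in> symN N" and "cst (- 1) * f \<in> symN N" if "f \<in> symN N" for f
    using that symN_cst_mult[of f N 0] symN_cst_mult[of f N "-1"] by (simp_all add: cst_simps)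
  \<comment> \<open>For \<open>n\<close> nonzero one of the two coefficients is 0, so their
    difference determines the other up to sign.\<close>
  consider "n = 0" | "n > 0" | "n < 0" by linarith
  then have "psi_plus_coeff N n * f \<in> symN N \<and> psi_minus_coeff N n * f \<in> symN N" if f: "f \<in> symN N" for f
  proof cases
    case 1
    with f show ?thesis by (simp add: psi_coeff_0)
  next
    case 2
    then have "psi_minus_coeff N n = 0" by (simp add: psi_minus_coeff_def)
    with *[OF f] zero[OF f] show ?thesis by simp
  next
    case 3
    then have "psi_plus_coeff N n = 0" by (simp add: psi_plus_coeff_def)
    with *[OF f] zero[OF f] symN_cst_mult[OF *[OF f], of "- 1"] show ?thesis
      by (simp add: cst_minus cst_simps)
  qed
  then show "preserves_sym N (psi_plus N n)" "preserves_sym N (psi_minus N n)"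
    by (simp_all add: preserves_sym_def psi_plus_def psi_minus_def)
qed

theorem theorem3p4:
  fixes N :: nat
  assumes "N \<ge> 1"
  shows
    "(\<forall>n. preserves_sym N (cur_e N n) \<and> preserves_sym N (cur_f N n) \<and>
          preserves_sym N (psi_plus N n) \<and> preserves_sym N (psi_minus N n)) \<and>
     ser_eq N (g_zw \<odot>\<^sub>s prod_zw (cur_e N) (cur_e N) \<oplus>\<^sub>s g_wz \<odot>\<^sub>s prod_wz (cur_e N) (cur_e N)) ser_zero \<and>
     ser_eq N (g_wz \<odot>\<^sub>s prod_zw (cur_f N) (cur_f N) \<oplus>\<^sub>s g_zw \<odot>\<^sub>s prod_wz (cur_f N) (cur_f N)) ser_zero \<and>
     (\<forall>\<psi> \<in> {psi_plus N, psi_minus N}.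
        ser_eq N (g_zw \<odot>\<^sub>s prod_zw \<psi> (cur_e N) \<oplus>\<^sub>s g_wz \<odot>\<^sub>s prod_wz (cur_e N) \<psi>) ser_zero \<and>
        ser_eq N (g_wz \<odot>\<^sub>s prod_zw \<psi> (cur_f N) \<oplus>\<^sub>s g_zw \<odot>\<^sub>s prod_wz (cur_f N) \<psi>) ser_zero) \<and>
     ser_eq N (prod_zw (cur_e N) (cur_f N) \<ominus>\<^sub>s prod_wz (cur_f N) (cur_e N))
       (Poly_Mapping.single 0 (1 / g_one_one) \<odot>\<^sub>s delta_mult (psi_plus N \<ominus>\<^sub>s psi_minus N)) \<and>
     ser_eq N (sym3 (z2_over_z3 \<odot>\<^sub>s double_comm (cur_e N))) ser_zero \<and>
     ser_eq N (sym3 (z2_over_z3 \<odot>\<^sub>s double_comm (cur_f N))) ser_zero \<and>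
     psi_plus_coeff N 0 = 1 \<and> psi_minus_coeff N 0 = 1 \<and>
     (\<forall>\<psi> \<in> {psi_plus N, psi_minus N}. \<forall>\<phi> \<in> {psi_plus N, psi_minus N}. \<forall>m n.
        \<forall>f \<in> symN N. \<psi> m (\<phi> n f) = \<phi> n (\<psi> m f))"
proof -
  have "psi_plus N = (\<lambda>n f. psi_plus_coeff N n * f)" "psi_minus N = (\<lambda>n f. psi_minus_coeff N n * f)"
    by (simp_all add: fun_eq_iff psi_plus_def psi_minus_def)
  then have psi_rel: "\<forall>\<psi> \<in> {psi_plus N, psi_minus N}.
      ser_eq N (g_zw \<odot>\<^sub>s prod_zw \<psi> (cur_e N) \<oplus>\<^sub>s g_wz \<odot>\<^sub>s prod_wz (cur_e N) \<psi>) ser_zero \<and>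
      ser_eq N (g_wz \<odot>\<^sub>s prod_zw \<psi> (cur_f N) \<oplus>\<^sub>s g_zw \<odot>\<^sub>s prod_wz (cur_f N) \<psi>) ser_zero"
    using psi_relations[of "psi_plus_coeff N" N] psi_relations[of "psi_minus_coeff N" N] by auto
  have psi_commute: "\<forall>\<psi> \<in> {psi_plus N, psi_minus N}. \<forall>\<phi> \<in> {psi_plus N, psi_minus N}. \<forall>m n.
      \<forall>f \<in> symN N. \<psi> m (\<phi> n f) = \<phi> n (\<psi> m f)"
    by (auto simp: psi_plus_def psi_minus_def mult_ac)
  show ?thesis
    by (intro conjI allI cur_preserve psi_preserve e_e_relation f_f_relation psi_rel e_f_relation
        e_serre f_serre psi_coeff_0 psi_commute)
qed

end
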